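(* Let $\mu\subset\lambda$ be partitions and let $r\ge1$ be an integer with $r\ge\ell(\lambda)$ (pad $\lambda,\mu$ with zeros to $r$ parts). Then $$g_{\lambda/\mu}(x)=\det\left(\sum_{n=0}^\infty\binom{j-i}{n}\beta^n\,h_{\lambda_i-\mu_j-i+j-n}(x)\right)_{1\le i,j\le r}.$$
   Context: $k=\mathbb{C}(\beta)$; $\Lambda$ is the $k$-algebra of symmetric functions in $x=(x_1,x_2,\dots)$, with Schur functions $s_\lambda$, complete symmetric functions $h_m$ ($h_0=1$, $h_m=0$ for $m<0$), and Hall inner product $\langle s_\lambda,s_\mu\rangle=\delta_{\lambda,\mu}$. $I_n=\mathrm{span}_k\{s_\lambda:\ell(\lambda)>n\}$ and $\widehat\Lambda=\varprojlim\Lambda/I_n$; elements of $\widehat\Lambda$ are formal sums $\sum c_\lambda s_\lambda$ such that for every $n$ only finitely many $\lambda$ with $\ell(\lambda)\le n$ have $c_\lambda\neq0$. The Hall product extends to $\widehat\Lambda\times\Lambda\to k$. The stable Grothendieck polynomial $G_\lambda(x)\in\widehat\Lambda$ is the unique element such that for all $n\ge\ell(\lambda)$, $G_\lambda(x_1,\dots,x_n,0,0,\dots)=\det\bigl(x_i^{\lambda_j+n-j}(1+\beta x_i)^{j-1}\bigr)_{1\le i,j\le n}/\prod_{1\le i<j\le n}(x_i-x_j)$. The dual stable Grothendieck polynomials $g_\mu\in\Lambda$ are determined by $\langle G_\lambda,g_\mu\rangle=\delta_{\lambda,\mu}$. The skew dual stable Grothendieck polynomial is $g_{\lambda/\mu}=G_\mu^\perp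 g_\lambda\in\Lambda$, i.e. $\langle g_{\lambda/\mu},h\rangle=\langle G_\mu h,g_\lambda\rangle$ for all $h\in\Lambda$ (equivalently $g_\lambda(x,y)=\sum_{\mu\subset\lambda}g_\mu(x)g_{\lambda/\mu}(y)$). Binomials: $\binom{a}{n}=a(a-1)\cdots(a-n+1)/n!$ for $a\in\mathbb Z$, $n\ge0$. *)

theory Defs
  imports
    "HOL-Computational_Algebra.Fraction_Field"
    "HOL-Library.Groups_Big_Fun"
    "HOL-Library.Multiset"
    "Jordan_Normal_Form.Determinant"
begin

section \<open>Formal power series in countably many variables\<close>

text \<open>
  The variables are indexed from 0, so the variable \<open>x\<^sub>i\<^sub>+\<^sub>1\<close> of the literature is \<open>Var i\<close> below.
  A monomial is the finite multiset of the indices of its variables: \<open>count M i\<close> is the exponent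
  of the variable with index \<open>i\<close>, \<open>size M\<close> the total degree, and multiplying monomials is adding
  multisets.
\<close>

typedef 'a mps = "UNIV :: (nat multiset \<Rightarrow> 'a) set"
  morphisms mps_coeff Abs_mps ..

setup_lifting type_definition_mps

lemma finite_mset_splits: "finite {(A, B). A + B = (M :: 'b multiset)}"
proof (induction M)
  case empty
  have "{(A, B). A + B = ({#} :: 'b multiset)} \<subseteq> {({#}, {#})}" by auto
  then show ?case by (rule finite_subset) simp
next
  case (add x N)
  let ?S = "{(A, B). A + B = N}"
  have "{(A, B). A + B = add_mset x N} \<subseteq>
      (\<lambda>(A, B). (add_mset x A, B)) ` ?S \<union> (\<lambda>(A, B). (A, add_mset x B)) ` ?S"
  proof clarify
    fix A B
    assume eq: "A + B = add_mset x N"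
      and notin: "(A, B) \<notin> (\<lambda>(A, B). (A, add_mset x B)) ` ?S"
    have "x \<in># A + B" using eq by simp
    then consider A' where "A = add_mset x A'" | B' where "B = add_mset x B'"
      by (metis mset_add union_iff)
    then show "(A, B) \<in> (\<lambda>(A, B). (add_mset x A, B)) ` ?S"
    proof cases
      case 1
      then have "A' + B = N" using eq by simp
      then show ?thesis using 1 by (auto simp: image_iff)
    next
      case 2
      then have "A + B' = N" using eq by simp
      then have "(A, B) \<in> (\<lambda>(A, B). (A, add_mset x B)) ` ?S" using 2 by (auto simp: image_iff)
      then show ?thesis using notin by blast
    qed
  qed
  then show ?case by (rule finite_subset) (use add.IH in simp)
qed

lift_definition mps_monom :: "nat multiset \<Rightarrow> 'a :: zero \<Rightarrow> 'a mps"
  is "\<lambda>M c N. if N = M then c else 0" .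

instantiation mps :: (comm_ring_1) comm_ring_1
begin

lift_definition zero_mps :: "'a mps" is "\<lambda>_. 0" .
lift_definition one_mps :: "'a mps" is "\<lambda>M. if M = {#} then 1 else 0" .
lift_definition plus_mps :: "'a mps \<Rightarrow> 'a mps \<Rightarrow> 'a mps" is "\<lambda>f g M. f M + g M" .
lift_definition minus_mps :: "'a mps \<Rightarrow> 'a mps \<Rightarrow> 'a mps" is "\<lambda>f g M. f M - g M" .
lift_definition uminus_mps :: "'a mps \<Rightarrow> 'a mps" is "\<lambda>f M. - f M" .
lift_definition times_mps :: "'a mps \<Rightarrow> 'a mps \<Rightarrow> 'a mps"
  is "\<lambda>f g M. \<Sum>(A, B) | A + B = M. f A * g B" .

instance
proof
  fix a b c :: "'a mps"
  show "a + b + c = a + (b + c)" "a + b = b + a" "0 + a = a" "- a + a = 0" "a - b = a + - b"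
    by (transfer; simp add: fun_eq_iff algebra_simps)+
  show "(0 :: 'a mps) \<noteq> 1"
    by transfer (auto simp: fun_eq_iff)
  show "(a + b) * c = a * c + b * c"
    by transfer (simp add: fun_eq_iff case_prod_beta distrib_right sum.distrib)
  show "a * b = b * a"
  proof (transfer, rule ext)
    fix f g :: "nat multiset \<Rightarrow> 'a" and M
    show "(\<Sum>(A, B) | A + B = M. f A * g B) = (\<Sum>(A, B) | A + B = M. g A * f B)"
      by (rule sum.reindex_bij_witness[of _ prod.swap prod.swap])
        (auto simp: add.commute mult.commute)
  qed
  show "1 * a = a"
  proof (transfer, rule ext)
    fix f :: "nat multiset \<Rightarrow> 'a" and M
    have "(\<Sum>(A, B) | A + B = M. (if A = {#} then 1 else 0) * f B)
        = (\<Sum>p\<in>{({#} :: nat multiset, M)}. (if fst p = {#} then 1 else 0) * f (snd p))"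
      unfolding case_prod_beta
      by (rule sum.mono_neutral_right[OF finite_mset_splits[of M, unfolded case_prod_beta]]) auto
    then show "(\<Sum>(A, B) | A + B = M. (if A = {#} then 1 else 0) * f B) = f M" by simp
  qed
  show "a * b * c = a * (b * c)"
  proof (transfer, rule ext)
    fix f g h :: "nat multiset \<Rightarrow> 'a" and M
    have "(\<Sum>(A, B) | A + B = M. (\<Sum>(C, D) | C + D = A. f C * g D) * h B)
        = (\<Sum>p \<in> {(A, B). A + B = M}. \<Sum>q \<in> {(C, D). C + D = fst p}.
            f (fst q) * g (snd q) * h (snd p))"
      by (simp add: case_prod_beta sum_distrib_right)
    also have "\<dots> = (\<Sum>(p, q) \<in> Sigma {(A, B). A + B = M} (\<lambda>p. {(C, D). C + D = fst p}).
            f (fst q) * g (snd q) * h (snd p))"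
      by (rule sum.Sigma) (auto simp: finite_mset_splits)
    also have "\<dots> = (\<Sum>(p, q) \<in> Sigma {(A, B). A + B = M} (\<lambda>p. {(C, D). C + D = snd p}).
            f (fst p) * (g (fst q) * h (snd q)))"
      by (rule sum.reindex_bij_witness
            [of _ "\<lambda>((A, B), (C, D)). ((A + C, D), (A, C))"
                  "\<lambda>((A, B), (C, D)). ((C, D + B), (D, B))"])
        (auto simp: ac_simps)
    also have "\<dots> = (\<Sum>p \<in> {(A, B). A + B = M}. \<Sum>q \<in> {(C, D). C + D = snd p}.
            f (fst p) * (g (fst q) * h (snd q)))"
      by (rule sum.Sigma[symmetric]) (auto simp: finite_mset_splits)
    also have "\<dots> = (\<Sum>(A, B) | A + B = M. f A * (\<Sum>(C, D) | C + D = B. g C * h D))"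
      by (simp add: case_prod_beta sum_distrib_left)
    finally show "(\<Sum>(A, B) | A + B = M. (\<Sum>(C, D) | C + D = A. f C * g D) * h B)
        = (\<Sum>(A, B) | A + B = M. f A * (\<Sum>(C, D) | C + D = B. g C * h D))" .
  qed
qed

end

definition Const :: "'a :: zero \<Rightarrow> 'a mps" where
  "Const c = mps_monom {#} c"

definition Var :: "nat \<Rightarrow> 'a :: zero_neq_one mps" where
  "Var i = mps_monom {#i#} 1"

text \<open>\<open>restrict_vars n f\<close> is \<open>f(x\<^sub>1, \<dots>, x\<^sub>n, 0, 0, \<dots>)\<close>.\<close>

lift_definition restrict_vars :: "nat \<Rightarrow> 'a :: zero mps \<Rightarrow> 'a mps"
  is "\<lambda>n f M. if set_mset M \<subseteq> {..<n} then f M else 0" .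

definition vandermonde :: "nat \<Rightarrow> 'a :: comm_ring_1 mps" where
  "vandermonde n = (\<Prod>(i, j) | i < j \<and> j < n. Var i - Var j)"


section \<open>Partitions\<close>

text \<open>A partition is padded with infinitely many zeros; \<open>part \<lambda> i\<close> is the part \<open>\<lambda>\<^sub>i\<^sub>+\<^sub>1\<close>.\<close>

typedef partition = "{f :: nat \<Rightarrow> nat. antimono f \<and> finite {i. f i \<noteq> 0}}"
  morphisms part Abs_partition
  by (rule exI[of _ "\<lambda>_. 0"]) (simp add: antimono_def)

setup_lifting type_definition_partition

definition plength :: "partition \<Rightarrow> nat" where
  "plength la = card {i. part la i \<noteq> 0}"

definition contained :: "partition \<Rightarrow> partition \<Rightarrow> bool" where
  "contained mu la \<longleftrightarrow> (\<forall>i. part mu i \<le> part la i)"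


section \<open>Symmetric functions over \<open>\<complex>(\<beta>)\<close>\<close>

type_synonym coef = "complex poly fract"

definition beta :: coef where
  "beta = Fract [:0, 1:] 1"

text \<open>
  This is \<open>a gchoose n\<close> at type \<open>int\<close>, written out because the sort constraint of \<open>gchoose\<close> may
  exclude \<open>int\<close>, depending on the order of imports. The division is exact: a product of \<open>n\<close>
  consecutive integers is divisible by \<open>n!\<close>.
\<close>

definition int_binomial :: "int \<Rightarrow> nat \<Rightarrow> int" where
  "int_binomial a n = (\<Prod>i = 0..<n. a - int i) div fact n"

definition symmetric_functions :: "coef mps set" where
  "symmetric_functions =
    {f. (\<forall>\<sigma> M. bij \<sigma> \<longrightarrow> mps_coeff f (image_mset \<sigma> M) = mps_coeff f M) \<and>
        (\<exists>d. \<forall>M. mps_coeff f M \<noteq> 0 \<longrightarrow> size M \<le> d)}"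

text \<open>The index is an integer because the complete symmetric functions of negative degree
  are needed too; they vanish.\<close>

lift_definition complete_sym :: "int \<Rightarrow> 'a :: zero_neq_one mps"
  is "\<lambda>m M. if int (size M) = m then 1 else 0" .

text \<open>
  The Schur function is the limit of the Schur polynomials, i.e. of the bialternants
  \<open>det (x\<^sub>i\<^bsup>\<lambda>\<^sub>j + n - j\<^esup>) / \<Prod>\<^sub>i\<^sub><\<^sub>j (x\<^sub>i - x\<^sub>j)\<close>. The ring of power series has no zero divisors, so the
  quotient is expressed by clearing its denominator, both here and for the stable Grothendieck
  polynomials. With indices from 0, the exponent \<open>\<lambda>\<^sub>j + n - j\<close> becomes \<open>part la j + (n - Suc j)\<close>.
\<close>

definition schur :: "partition \<Rightarrow> coef mps" where
  "schur la = (THE s. s \<in> symmetric_functions \<and>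
     (\<forall>n \<ge> plength la. restrict_vars n s * vandermonde n =
        det (mat n n (\<lambda>(i, j). Var i ^ (part la j + (n - Suc j))))))"

text \<open>
  The formal sum \<open>\<Sum>\<^sub>\<lambda> c\<^sub>\<lambda> s\<^sub>\<lambda>\<close> is realized as a power series: since \<open>s\<^sub>\<lambda>\<close> is homogeneous of degree
  \<open>|\<lambda>|\<close>, only finitely many summands contribute to the coefficient of a given monomial.
  As the Schur functions are linearly independent, this identifies the projective limit of the
  quotients of the ring of symmetric functions by the spans of \<open>{s\<^sub>\<lambda>. \<ell>(\<lambda>) > n}\<close> with a ring of
  power series, compatibly with restriction to \<open>n\<close> variables and with multiplication.
\<close>

definition schur_series :: "(partition \<Rightarrow> coef) \<Rightarrow> coef mps" where
  "schur_series c = Abs_mps (\<lambda>M. Sum_any (\<lambda>la. c la * mps_coeff (schur la) M))"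

definition completed_symmetric_functions :: "coef mps set" where
  "completed_symmetric_functions =
    {schur_series c | c. \<forall>n. finite {la. plength la \<le> n \<and> c la \<noteq> 0}}"

definition schur_coeff :: "coef mps \<Rightarrow> partition \<Rightarrow> coef" where
  "schur_coeff F = (THE c. F = schur_series c)"

text \<open>Meaningful for \<open>F\<close> in the completed ring and \<open>f\<close> symmetric of bounded degree, in which case
  the sum is finite.\<close>

definition hall :: "coef mps \<Rightarrow> coef mps \<Rightarrow> coef" where
  "hall F f = Sum_any (\<lambda>la. schur_coeff F la * schur_coeff f la)"


section \<open>Stable Grothendieck polynomials and their duals\<close>

definition stable_grothendieck :: "partition \<Rightarrow> coef mps" where
  "stable_grothendieck la = (THE F. F \<in> completed_symmetric_functions \<and>
     (\<forall>n \<ge> plength la. restrict_vars n F * vandermonde n =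
        det (mat n n (\<lambda>(i, j).
          Var i ^ (part la j + (n - Suc j)) * (1 + Const beta * Var i) ^ j))))"

definition dual_grothendieck :: "partition \<Rightarrow> coef mps" where
  "dual_grothendieck mu = (THE g. g \<in> symmetric_functions \<and>
     (\<forall>la. hall (stable_grothendieck la) g = (if la = mu then 1 else 0)))"

definition skew_dual_grothendieck :: "partition \<Rightarrow> partition \<Rightarrow> coef mps" where
  "skew_dual_grothendieck la mu = (THE g. g \<in> symmetric_functions \<and>
     (\<forall>h \<in> symmetric_functions.
        hall g h = hall (stable_grothendieck mu * h) (dual_grothendieck la)))"

end

theory Submission
  imports Defs "HOL-Computational_Algebra.Formal_Power_Series"
begin

text \<open>
  The coefficient of \<open>s\<^sub>\<lambda>\<close> in a symmetric series \<open>F\<close> is the coefficient of \<open>x\<^bsup>\<lambda>+\<delta>\<^esup>\<close> in \<open>F\<close> times the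
  Vandermonde product of sufficiently many variables. Together with the Jacobi--Trudi formula this
  yields the duality \<open>\<langle>F, h\<^sub>a\<^sub>1 \<cdots> h\<^sub>a\<^sub>r\<rangle> = [x\<^sup>a] F\<close>. Expanding the determinant \<open>D\<^bsub>\<lambda>/\<mu>\<^esub>\<close> of the theorem, whose
  rows carry the binomial series of \<open>(1 + \<beta>x\<^sub>i)\<^bsup>j-i\<^esup>\<close>, the duality gives
  \<open>\<langle>F, D\<^bsub>\<lambda>/\<mu>\<^esub>\<rangle> = [x\<^bsup>\<lambda>+\<delta>\<^esup>] F \<Prod>\<^sub>i (1 + \<beta>x\<^sub>i)\<^bsup>-i\<^esup> A\<^sub>\<mu>\<close>, where \<open>A\<^sub>\<mu>\<close> is the numerator of \<open>G\<^sub>\<mu>\<close>. As \<open>A\<^sub>\<mu>\<close> is \<open>G\<^sub>\<mu>\<close>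
  times the Vandermonde product, which is \<open>A\<close> for the empty partition, this says
  \<open>\<langle>h, D\<^bsub>\<lambda>/\<mu>\<^esub>\<rangle> = \<langle>G\<^sub>\<mu> h, D\<^bsub>\<lambda>/\<emptyset>\<^esub>\<rangle>\<close>. For \<open>h = 1\<close> the left-hand side is a determinant of binomial coefficients
  equal to \<open>\<delta>\<^sub>\<lambda>\<^sub>\<mu>\<close>, so \<open>D\<^bsub>\<lambda>/\<emptyset>\<^esub> = g\<^sub>\<lambda>\<close>, and then \<open>D\<^bsub>\<lambda>/\<mu>\<^esub> = g\<^bsub>\<lambda>/\<mu>\<^esub>\<close>.
\<close>

section \<open>Coefficients of power series\<close>

lemma mps_eqI: "(\<And>M. mps_coeff f M = mps_coeff g M) \<Longrightarrow> f = g"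
  by (metis ext mps_coeff_inject)

lemma coeff_zero [simp]: "mps_coeff 0 M = 0"
  by (simp add: zero_mps.rep_eq)

lemma coeff_one: "mps_coeff 1 M = (if M = {#} then 1 else 0)"
  by (simp add: one_mps.rep_eq)

lemma coeff_plus [simp]: "mps_coeff (f + g) M = mps_coeff f M + mps_coeff g M"
  by (simp add: plus_mps.rep_eq)

lemma coeff_minus [simp]: "mps_coeff (f - g) M = mps_coeff f M - mps_coeff g M"
  by (simp add: minus_mps.rep_eq)

lemma coeff_mult: "mps_coeff (f * g) M = (\<Sum>(A, B) | A + B = M. mps_coeff f A * mps_coeff g B)"
  by (simp add: times_mps.rep_eq)

lemma coeff_sum [simp]: "mps_coeff (sum f S) M = (\<Sum>i\<in>S. mps_coeff (f i) M)"
  by (induction S rule: infinite_finite_induct) auto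

lemma coeff_mps_monom: "mps_coeff (mps_monom B c) M = (if M = B then c else 0)"
  by (simp add: mps_monom.rep_eq)

lemma coeff_mps_monom_mult:
  "mps_coeff (mps_monom B c * f) M = (if B \<subseteq># M then c * mps_coeff f (M - B) else 0)"
proof (cases "B \<subseteq># M")
  case True
  have "mps_coeff (mps_monom B c * f) M
      = (\<Sum>p\<in>{(B, M - B)}. mps_coeff (mps_monom B c) (fst p) * mps_coeff f (snd p))"
    unfolding coeff_mult case_prod_beta
    by (rule sum.mono_neutral_right[OF finite_mset_splits[of M, unfolded case_prod_beta]])
      (use True in \<open>auto simp: coeff_mps_monom\<close>)
  then show ?thesis using True by (simp add: coeff_mps_monom)
next
  case False
  then show ?thesis
    unfolding coeff_mult by (auto simp: coeff_mps_monom intro!: sum.neutral)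
qed

lemma coeff_Const: "mps_coeff (Const c) M = (if M = {#} then c else 0)"
  by (simp add: Const_def coeff_mps_monom)

lemma coeff_Const_mult [simp]: "mps_coeff (Const c * f) M = c * mps_coeff f M"
  by (simp add: Const_def coeff_mps_monom_mult)

lemma Const_hom: "comm_ring_hom (Const :: 'a :: comm_ring_1 \<Rightarrow> 'a mps)"
  by unfold_locales (auto intro!: mps_eqI simp: coeff_Const coeff_one)

interpretation Const: comm_ring_hom "Const :: 'a :: comm_ring_1 \<Rightarrow> 'a mps"
  by (rule Const_hom)

lemma coeff_of_int_mult [simp]: "mps_coeff (of_int k * f) M = of_int k * mps_coeff f M"
  using coeff_Const_mult[of "of_int k" f M] by (simp add: Const.hom_of_int)

lemma monom_mult_monom: "mps_monom A a * mps_monom B b = mps_monom (A + B) (a * b)"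
  for a b :: "'a :: comm_ring_1"
  by (rule mps_eqI) (auto simp: coeff_mps_monom_mult coeff_mps_monom)

lemma Var_power: "Var i ^ k = mps_monom (replicate_mset k i) (1 :: 'a :: comm_ring_1)"
  by (induction k)
    (auto simp: Var_def monom_mult_monom intro: mps_eqI simp: coeff_one coeff_mps_monom)

lemma mps_coeff_Abs [simp]: "mps_coeff (Abs_mps f) = f"
  by (simp add: Abs_mps_inverse)

section \<open>Setting all but finitely many variables to zero\<close>

lemma coeff_restrict: "mps_coeff (restrict_vars n f) M = (if set_mset M \<subseteq> {..<n} then mps_coeff f M else 0)"
  by (simp add: restrict_vars.rep_eq)

text \<open>Multiplicativity holds because a product of monomials involves only the first
  \<open>n\<close> variables exactly if both factors do.\<close>

lemma restrict_hom: "comm_ring_hom (restrict_vars n :: 'a :: comm_ring_1 mps \<Rightarrow> _)"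
proof
  fix x y :: "'a mps"
  show "restrict_vars n (x * y) = restrict_vars n x * restrict_vars n y"
  proof (rule mps_eqI)
    fix M
    show "mps_coeff (restrict_vars n (x * y)) M = mps_coeff (restrict_vars n x * restrict_vars n y) M"
    proof (cases "set_mset M \<subseteq> {..<n}")
      case True
      then show ?thesis
        unfolding coeff_restrict coeff_mult
        by (simp, intro sum.cong refl) (use True in \<open>force simp: coeff_restrict\<close>)
    next
      case False
      then show ?thesis
        unfolding coeff_restrict coeff_mult
        by (subst sum.neutral) (auto simp: coeff_restrict)
    qed
  qed
qed (auto intro!: mps_eqI simp: coeff_restrict coeff_one)

interpretation restrict: comm_ring_hom "restrict_vars n :: 'a :: comm_ring_1 mps \<Rightarrow> _"
  for n by (rule restrict_hom)

lemma restrict_Const [simp]: "restrict_vars n (Const c) = Const c"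
  by (rule mps_eqI) (auto simp: coeff_restrict coeff_Const)

lemma restrict_Var: "restrict_vars n (Var i) = (if i < n then Var i else (0 :: 'a :: comm_ring_1 mps))"
  by (rule mps_eqI) (auto simp: coeff_restrict Var_def coeff_mps_monom)

text \<open>Every monomial involves finitely many variables, so all large \<open>n\<close> see its
  coefficient. The bound \<open>N\<close> is there because the defining identities start only at the
  length of the partition.\<close>

lemma mps_eq_restrictI:
  assumes "\<And>n. n \<ge> N \<Longrightarrow> restrict_vars n f = restrict_vars n g"
  shows "f = g"
proof (rule mps_eqI)
  fix M :: "nat multiset"
  obtain n where n: "set_mset M \<subseteq> {..<n}"
    using finite_nat_bounded[of "set_mset M"] by auto
  then have "set_mset M \<subseteq> {..<max n N}" by auto
  then show "mps_coeff f M = mps_coeff g M"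
    using arg_cong[OF assms[of "max n N"], of "\<lambda>f. mps_coeff f M"] by (simp add: coeff_restrict)
qed

section \<open>Permuting the variables\<close>

lift_definition permute_vars :: "(nat \<Rightarrow> nat) \<Rightarrow> 'a mps \<Rightarrow> 'a mps"
  is "\<lambda>\<sigma> f M. f (image_mset \<sigma> M)" .

lemma coeff_permute: "mps_coeff (permute_vars \<sigma> f) M = mps_coeff f (image_mset \<sigma> M)"
  by (simp add: permute_vars.rep_eq)

lemma image_mset_inv:
  assumes "bij \<sigma>"
  shows "image_mset \<sigma> (image_mset (inv_into UNIV \<sigma>) M) = M" "image_mset (inv_into UNIV \<sigma>) (image_mset \<sigma> M) = M"
  using assms by (simp_all add: multiset.map_comp bij_is_surj surj_iff[symmetric] bij_is_inj
      inj_iff[symmetric] image_mset.compositionality surj_f_inv_f inv_f_f comp_def)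

lemma permute_hom:
  assumes "bij \<sigma>"
  shows "comm_ring_hom (permute_vars \<sigma> :: 'a :: comm_ring_1 mps \<Rightarrow> _)"
proof
  fix x y :: "'a mps"
  show "permute_vars \<sigma> (x * y) = permute_vars \<sigma> x * permute_vars \<sigma> y"
  proof (rule mps_eqI)
    fix M
    show "mps_coeff (permute_vars \<sigma> (x * y)) M = mps_coeff (permute_vars \<sigma> x * permute_vars \<sigma> y) M"
      unfolding coeff_permute coeff_mult
      by (rule sum.reindex_bij_witness
            [of _ "\<lambda>(A, B). (image_mset \<sigma> A, image_mset \<sigma> B)"
                  "\<lambda>(A, B). (image_mset (inv_into UNIV \<sigma>) A, image_mset (inv_into UNIV \<sigma>) B)"])
        (auto simp: image_mset_inv[OF assms] coeff_permute simp flip: image_mset_union)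
  qed
qed (auto intro!: mps_eqI simp: coeff_permute coeff_one)

text \<open>\<open>permute_vars\<close> reads coefficients at the image monomial, so as a
  substitution it acts by the inverse of \<sigma>.\<close>

lemma permute_Var:
  assumes "bij \<sigma>"
  shows "permute_vars \<sigma> (Var i) = Var (inv_into UNIV \<sigma> i)"
proof (rule mps_eqI)
  fix M
  have "image_mset \<sigma> M = {#i#} \<longleftrightarrow> M = {#inv_into UNIV \<sigma> i#}"
    using image_mset_inv[OF assms, of M] image_mset_inv[OF assms, of "{#i#}"] by auto
  then show "mps_coeff (permute_vars \<sigma> (Var i)) M = mps_coeff (Var (inv_into UNIV \<sigma> i)) M"
    by (simp add: coeff_permute Var_def coeff_mps_monom)
qed

lemma permute_Const:
  assumes "bij \<sigma>"
  shows "permute_vars \<sigma> (Const c) = Const c"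
  by (rule mps_eqI) (simp add: coeff_permute coeff_Const)

section \<open>Power series in a single one of the variables\<close>

lift_definition fps_var :: "nat \<Rightarrow> 'a :: zero fps \<Rightarrow> 'a mps"
  is "\<lambda>i u M. if M = replicate_mset (size M) i then fps_nth u (size M) else 0" .

lemma coeff_fps_var:
  "mps_coeff (fps_var i u) M = (if M = replicate_mset (size M) i then fps_nth u (size M) else 0)"
  by (simp add: fps_var.rep_eq)

lemma coeff_fps_var_replicate [simp]: "mps_coeff (fps_var i u) (replicate_mset k i) = fps_nth u k"
  by (simp add: coeff_fps_var)

lemma coeff_mult_fps_var:
  "mps_coeff (f * fps_var i u) M
     = (\<Sum>k\<le>count M i. mps_coeff f (M - replicate_mset k i) * fps_nth u k)"
proof -
  have sub: "replicate_mset k i \<subseteq># M" if "k \<le> count M i" for k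
    using that by (simp add: count_le_replicate_mset_subset_eq)
  have size: "size B \<le> count M i" if "A + B = M" "B = replicate_mset (size B) i" for A B
    using that by (metis count_replicate_mset count_union le_add2)
  have "(\<Sum>k\<le>count M i. mps_coeff f (M - replicate_mset k i) * fps_nth u k)
     = (\<Sum>(A, B) | A + B = M \<and> B = replicate_mset (size B) i. mps_coeff f A * mps_coeff (fps_var i u) B)"
  proof (rule sum.reindex_bij_witness
      [of _ "\<lambda>p. size (snd p)" "\<lambda>k. (M - replicate_mset k i, replicate_mset k i)"], goal_cases)
    case (4 p)
    then show ?case using size[of "fst p" "snd p"] by auto
  next
    case (3 p)
    then show ?case by (auto simp: prod_eq_iff)
  qed (auto simp: sub)
  also have "\<dots> = mps_coeff (f * fps_var i u) M"
    unfolding coeff_mult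
    by (rule sum.mono_neutral_left)
      (use finite_mset_splits[of M] in \<open>auto simp: coeff_fps_var split: if_splits\<close>)
  finally show ?thesis ..
qed

lemma fps_var_hom: "comm_ring_hom (fps_var i :: 'a :: comm_ring_1 fps \<Rightarrow> _)"
proof
  fix x y :: "'a fps"
  show "fps_var i (x * y) = fps_var i x * fps_var i y"
  proof (rule mps_eqI)
    fix M
    show "mps_coeff (fps_var i (x * y)) M = mps_coeff (fps_var i x * fps_var i y) M"
    proof (cases "M = replicate_mset (size M) i")
      case True
      then obtain m where M: "M = replicate_mset m i" by blast
      have sub: "replicate_mset m i - replicate_mset k i = replicate_mset (m - k) i" for k
        by (rule multiset_eqI) simp
      have "mps_coeff (fps_var i x * fps_var i y) M = (\<Sum>k\<le>m. fps_nth x (m - k) * fps_nth y k)"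
        unfolding coeff_mult_fps_var by (simp add: M sub)
      also have "\<dots> = (\<Sum>k=0..m. fps_nth x k * fps_nth y (m - k))"
        by (rule sum.reindex_bij_witness[of _ "\<lambda>k. m - k" "\<lambda>k. m - k"]) auto
      finally show ?thesis by (simp add: M fps_mult_nth)
    next
      case False
      have "mps_coeff (fps_var i x) (M - replicate_mset k i) = 0" if "k \<le> count M i" for k
      proof -
        have "M - replicate_mset k i \<noteq> replicate_mset l i" for l
        proof
          assume "M - replicate_mset k i = replicate_mset l i"
          then have "M = replicate_mset (k + l) i"
            using that
            by (intro multiset_eqI) (metis (no_types, lifting) count_diff count_replicate_mset
                count_union le_add_diff_inverse add.left_neutral minus_nat.diff_0)
          with False show False by simp
        qed
        then show ?thesis by (auto simp: coeff_fps_var)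
      qed
      then show ?thesis unfolding coeff_mult_fps_var using False by (simp add: coeff_fps_var)
    qed
  qed
qed (auto intro!: mps_eqI simp: coeff_fps_var coeff_one)

interpretation fps_var: comm_ring_hom "fps_var i :: 'a :: comm_ring_1 fps \<Rightarrow> _"
  for i by (rule fps_var_hom)

lemma fps_var_X [simp]: "fps_var i fps_X = (Var i :: 'a :: comm_ring_1 mps)"
proof (rule mps_eqI)
  fix M :: "nat multiset"
  show "mps_coeff (fps_var i fps_X) M = mps_coeff (Var i :: 'a mps) M"
    by (cases "M = {#i#}") (auto simp: coeff_fps_var Var_def coeff_mps_monom)
qed

lemma fps_var_const [simp]: "fps_var i (fps_const c) = Const c"
  by (rule mps_eqI) (auto simp: coeff_fps_var coeff_Const)

section \<open>Monomials given by exponent vectors, and products of series in separate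
  variables\<close>

definition expo_mset :: "(nat \<Rightarrow> nat) \<Rightarrow> nat \<Rightarrow> nat multiset" where
  "expo_mset a n = (\<Sum>i<n. replicate_mset (a i) i)"

lemma count_expo_mset [simp]: "count (expo_mset a n) i = (if i < n then a i else 0)"
  by (simp add: expo_mset_def count_sum)

lemma set_expo_mset: "set_mset (expo_mset a n) \<subseteq> {..<n}"
  by (metis count_expo_mset not_in_iff subsetI lessThan_iff)

lemma size_expo_mset: "size (expo_mset a n) = (\<Sum>i<n. a i)"
  by (simp add: expo_mset_def size_multiset_sum)

lemma expo_mset_count: "set_mset M \<subseteq> {..<n} \<Longrightarrow> expo_mset (count M) n = M"
  by (rule multiset_eqI) (auto simp: not_in_iff[symmetric])

lemma expo_mset_cong: "(\<And>i. i < n \<Longrightarrow> a i = b i) \<Longrightarrow> expo_mset a n = expo_mset b n"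
  by (rule multiset_eqI) auto

lemma coeff_prod_fps_var:
  "mps_coeff (\<Prod>i<n. fps_var i (u i)) M
     = (if set_mset M \<subseteq> {..<n} then \<Prod>i<n. fps_nth (u i) (count M i) else 0)"
  for u :: "nat \<Rightarrow> 'a :: comm_ring_1 fps"
proof (induction n arbitrary: M)
  case 0
  then show ?case by (simp add: coeff_one)
next
  case (Suc n)
  \<comment> \<open>The first \<open>n\<close> series lack the variable with index \<open>n\<close>,
    so the last factor must absorb its full power in \<open>M\<close>.\<close>
  have sub: "set_mset (M - replicate_mset k n) \<subseteq> {..<n} \<longleftrightarrow> set_mset M \<subseteq> {..<Suc n} \<and> k = count M n"
    if k: "k \<le> count M n" for k
  proof -
    have "count (M - replicate_mset k n) i = (if i = n then count M n - k else count M i)" for i by simp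
    then show ?thesis
      using k unfolding subset_iff
      by (metis count_greater_zero_iff less_antisym lessThan_iff less_Suc_eq order_less_irrefl zero_less_diff le_neq_implies_less)
  qed
  have "mps_coeff (\<Prod>i<Suc n. fps_var i (u i)) M =
     (\<Sum>k\<le>count M n. mps_coeff (\<Prod>i<n. fps_var i (u i)) (M - replicate_mset k n) * fps_nth (u n) k)"
    by (simp add: coeff_mult_fps_var)
  also have "\<dots> = (\<Sum>k\<le>count M n. if k = count M n then if set_mset M \<subseteq> {..<Suc n} then \<Prod>i<Suc n. fps_nth (u i) (count M i) else 0 else 0)"
    by (rule sum.cong[OF refl]) (auto simp: Suc.IH sub simp del: set_mset_diff)
  finally show ?case by simp
qed

text \<open>Row \<open>i\<close> involves only the variable with index \<open>i\<close>. Each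
  Leibniz term is thus a product over separate variables, and extracting the coefficient of x^a acts
  entrywise.\<close>

lemma coeff_expo_mset_det_fps_var:
  "mps_coeff (det (mat n n (\<lambda>(i, j). fps_var i (u i j)))) (expo_mset a n)
     = det (mat n n (\<lambda>(i, j). fps_nth (u i j) (a i)))"
  for u :: "nat \<Rightarrow> nat \<Rightarrow> 'a :: comm_ring_1 fps"
proof -
  have perm: "p permutes {0..<n} \<Longrightarrow> i < n \<Longrightarrow> p i < n" for p i
    by (metis atLeastLessThan_iff permutes_in_image le0)
  have "(\<Prod>i = 0..<n. mat n n (\<lambda>(i, j). fps_var i (u i j)) $$ (i, p i)) = (\<Prod>i<n. fps_var i (u i (p i)))"
    if "p permutes {0..<n}" for p
    using perm[OF that] by (auto simp: atLeast0LessThan intro!: prod.cong)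
  then show ?thesis
    by (simp add: det_def coeff_prod_fps_var set_expo_mset perm atLeast0LessThan)
qed

section \<open>Determinants\<close>

lemma det_mat_mult:
  "det (mat n n (\<lambda>(i, j). \<Sum>l<n. a i l * b l j)) = det (mat n n (\<lambda>(i, j). a i j)) * det (mat n n (\<lambda>(i, j). b i j))"
  for a b :: "nat \<Rightarrow> nat \<Rightarrow> 'a :: comm_ring_1"
proof -
  have "mat n n (\<lambda>(i, j). \<Sum>l<n. a i l * b l j) = mat n n (\<lambda>(i, j). a i j) * mat n n (\<lambda>(i, j). b i j)"
    by (rule eq_matI) (auto simp: scalar_prod_def atLeast0LessThan intro!: sum.cong)
  then show ?thesis by (simp add: det_mult[of _ n])
qed

lemma det_mat_transpose: "det (mat n n (\<lambda>(i, j). f i j)) = det (mat n n (\<lambda>(i, j). f j i))"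
  for f :: "nat \<Rightarrow> nat \<Rightarrow> 'a :: comm_ring_1"
proof -
  have "mat n n (\<lambda>(i, j). f i j) = transpose_mat (mat n n (\<lambda>(i, j). f j i))"
    by (rule eq_matI) auto
  then show ?thesis by (simp add: det_transpose[of _ n])
qed

lemma det_mat_upper:
  fixes f :: "nat \<Rightarrow> nat \<Rightarrow> 'a :: comm_ring_1"
  assumes "\<And>i j. j < i \<Longrightarrow> i < n \<Longrightarrow> f i j = 0"
  shows "det (mat n n (\<lambda>(i, j). f i j)) = (\<Prod>i<n. f i i)"
proof -
  have "det (mat n n (\<lambda>(i, j). f i j)) = prod_list (diag_mat (mat n n (\<lambda>(i, j). f i j)))"
    by (rule det_upper_triangular[of _ n]) (use assms in \<open>auto simp: upper_triangular_def\<close>)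
  also have "\<dots> = (\<Prod>i<n. f i i)"
    by (auto simp: diag_mat_def prod.distinct_set_conv_list[symmetric] atLeast0LessThan intro!: prod.cong)
  finally show ?thesis .
qed

lemma det_mat_lower:
  fixes f :: "nat \<Rightarrow> nat \<Rightarrow> 'a :: comm_ring_1"
  assumes "\<And>i j. i < j \<Longrightarrow> j < n \<Longrightarrow> f i j = 0"
  shows "det (mat n n (\<lambda>(i, j). f i j)) = (\<Prod>i<n. f i i)"
  by (subst det_mat_transpose) (use assms in \<open>auto intro: det_mat_upper\<close>)

text \<open>Laplace expansion along the last row. The stability statements in the number of
  variables or rows rest on this or on its transpose.\<close>

lemma det_mat_last_row:
  fixes f :: "nat \<Rightarrow> nat \<Rightarrow> 'a :: comm_ring_1"
  assumes "\<And>j. j < n \<Longrightarrow> f n j = 0" "f n n = 1"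
  shows "det (mat (Suc n) (Suc n) (\<lambda>(i, j). f i j)) = det (mat n n (\<lambda>(i, j). f i j))"
proof -
  have "mat_delete (mat (Suc n) (Suc n) (\<lambda>(i, j). f i j)) n n = mat n n (\<lambda>(i, j). f i j)"
    by (rule eq_matI) (auto simp: mat_delete_def)
  then show ?thesis
    by (subst laplace_expansion_row[of _ "Suc n" n]) (auto simp: assms cofactor_def)
qed

lemma det_mat_last_column:
  fixes f :: "nat \<Rightarrow> nat \<Rightarrow> 'a :: comm_ring_1"
  assumes "\<And>i. i < n \<Longrightarrow> f i n = 0" "f n n = 1"
  shows "det (mat (Suc n) (Suc n) (\<lambda>(i, j). f i j)) = det (mat n n (\<lambda>(i, j). f i j))"
  by (subst (1 2) det_mat_transpose) (rule det_mat_last_row[of n "\<lambda>i j. f j i", OF assms])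

lemma det_mat_mult_rows:
  "det (mat n n (\<lambda>(i, j). c i * f i j)) = (\<Prod>i<n. c i) * det (mat n n (\<lambda>(i, j). f i j))"
    for f :: "nat \<Rightarrow> nat \<Rightarrow> 'a :: comm_ring_1"
  by (auto simp: det_def atLeast0LessThan prod.distrib[symmetric] sum_distrib_left mult_ac
      permutes_in_image intro!: sum.cong arg_cong2[of _ _ _ _ "(*)"] prod.cong)

lemma (in comm_ring_hom) hom_det_mat:
  "hom (det (mat n n (\<lambda>(i, j). f i j))) = det (mat n n (\<lambda>(i, j). hom (f i j)))"
proof -
  have "map_mat hom (mat n n (\<lambda>(i, j). f i j)) = mat n n (\<lambda>(i, j). hom (f i j))"
    by (rule eq_matI) auto
  then show ?thesis by (metis hom_det)
qed

lemma det_mat_permutes_expand: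
  "det (mat n n (\<lambda>(i, j). f i j)) = (\<Sum>p | p permutes {..<n}. of_int (sign p) * (\<Prod>i<n. f i (p i)))"
    for f :: "nat \<Rightarrow> nat \<Rightarrow> 'a :: comm_ring_1"
  by (auto simp: det_def atLeast0LessThan
      intro!: sum.cong arg_cong2[of _ _ _ _ "(*)"] prod.cong)

text \<open>The evaluation matrix is the matrix of powers times the matrix of polynomial
  coefficients. Powers are listed in descending order to match the alternants.\<close>

lemma det_mat_poly:
  fixes x :: "nat \<Rightarrow> 'a :: comm_ring_1" and p :: "nat \<Rightarrow> 'a poly"
  assumes "\<And>j. j < n \<Longrightarrow> degree (p j) < n"
  shows "det (mat n n (\<lambda>(i, j). poly (p j) (x i)))
    = det (mat n n (\<lambda>(i, j). x i ^ (n - Suc j))) * det (mat n n (\<lambda>(l, j). poly.coeff (p j) (n - Suc l)))"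
proof -
  have "poly (p j) (x i) = (\<Sum>l<n. x i ^ (n - Suc l) * poly.coeff (p j) (n - Suc l))" if "j < n" for i j
  proof -
    have "poly (p j) (x i) = (\<Sum>k<n. poly.coeff (p j) k * x i ^ k)"
      unfolding poly_altdef using assms[OF that]
      by (intro sum.mono_neutral_left) (auto simp: coeff_eq_0)
    also have "\<dots> = (\<Sum>l<n. poly.coeff (p j) (n - Suc l) * x i ^ (n - Suc l))"
      by (rule sum.nat_diff_reindex[symmetric])
    finally show ?thesis by (simp add: mult.commute)
  qed
  then have "mat n n (\<lambda>(i, j). poly (p j) (x i))
      = mat n n (\<lambda>(i, j). \<Sum>l<n. x i ^ (n - Suc l) * poly.coeff (p j) (n - Suc l))"
    by (intro eq_matI) auto
  then show ?thesis by (simp add: det_mat_mult)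
qed

lemma coeff_prod_linear:
  fixes x :: "nat \<Rightarrow> 'a :: comm_ring_1"
  assumes "finite S"
  shows "degree (\<Prod>k\<in>S. [:- x k, 1:]) \<le> card S"
    and "poly.coeff (\<Prod>k\<in>S. [:- x k, 1:]) (card S) = 1"
proof -
  have "degree (\<Prod>k\<in>S. [:- x k, 1:]) \<le> card S \<and> poly.coeff (\<Prod>k\<in>S. [:- x k, 1:]) (card S) = 1"
    using assms
  proof induction
    case (insert a S)
    then show ?case
      using degree_mult_le[of "[:- x a, 1:]" "\<Prod>k\<in>S. [:- x k, 1:]"] by (auto simp: coeff_eq_0)
  qed auto
  then show "degree (\<Prod>k\<in>S. [:- x k, 1:]) \<le> card S"
    and "poly.coeff (\<Prod>k\<in>S. [:- x k, 1:]) (card S) = 1" by auto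
qed

text \<open>
  The powers are replaced by the monic polynomials \<open>p\<^sub>j = \<Prod>\<^sub>k\<^sub>>\<^sub>j (X - x\<^sub>k)\<close>; this does not change the
  determinant and makes the matrix triangular.
\<close>

lemma det_vandermonde:
  fixes x :: "nat \<Rightarrow> 'a :: comm_ring_1"
  shows "det (mat n n (\<lambda>(i, j). x i ^ (n - Suc j))) = (\<Prod>i<n. \<Prod>k\<in>{i<..<n}. x i - x k)"
proof -
  define p where "p j = (\<Prod>k\<in>{j<..<n}. [:- x k, 1:])" for j
  have deg: "degree (p j) \<le> n - Suc j" and one: "poly.coeff (p j) (n - Suc j) = 1" for j
    using coeff_prod_linear[of "{j<..<n}" x] by (auto simp: p_def)
  have "det (mat n n (\<lambda>(i, j). poly (p j) (x i))) = (\<Prod>i<n. poly (p i) (x i))"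
    by (rule det_mat_upper) (auto simp: p_def poly_prod intro!: prod_zero)
  also have "\<dots> = (\<Prod>i<n. \<Prod>k\<in>{i<..<n}. x i - x k)"
    by (simp add: p_def poly_prod)
  finally have "(\<Prod>i<n. \<Prod>k\<in>{i<..<n}. x i - x k) = det (mat n n (\<lambda>(i, j). poly (p j) (x i)))" ..
  also have "\<dots> = det (mat n n (\<lambda>(i, j). x i ^ (n - Suc j))) * det (mat n n (\<lambda>(l, j). poly.coeff (p j) (n - Suc l)))"
    by (rule det_mat_poly) (rule le_less_trans[OF deg], simp)
  also have "det (mat n n (\<lambda>(l, j). poly.coeff (p j) (n - Suc l))) = 1"
    by (subst det_mat_lower) (auto simp: one intro!: coeff_eq_0 le_less_trans[OF deg])
  finally show ?thesis by simp
qed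

section \<open>Alternants\<close>

text \<open>\<open>b = 0\<close> gives the numerator of the Schur function, \<open>b = beta\<close>
  that of the stable Grothendieck polynomial.\<close>

definition alternant :: "'a \<Rightarrow> partition \<Rightarrow> nat \<Rightarrow> 'a :: comm_ring_1 mps" where
  "alternant b la n =
     det (mat n n (\<lambda>(i, j). Var i ^ (part la j + (n - Suc j)) * (1 + Const b * Var i) ^ j))"

lemma vandermonde_eq: "vandermonde n = (\<Prod>i<n. \<Prod>k\<in>{i<..<n}. Var i - Var k)"
proof -
  have "{(i, j). i < j \<and> j < n} = Sigma {..<n} (\<lambda>i. {i<..<n})" by auto
  then show ?thesis
    unfolding vandermonde_def by (simp add: prod.Sigma)
qed

lemma vandermonde_det: "vandermonde n = det (mat n n (\<lambda>(i, j). Var i ^ (n - Suc j)))"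
  by (simp add: vandermonde_eq det_vandermonde)

definition empty_partition :: partition where
  "empty_partition = Abs_partition (\<lambda>_. 0)"

lemma part_empty [simp]: "part empty_partition i = 0"
  unfolding empty_partition_def by (subst Abs_partition_inverse) (auto simp: antimono_def)

text \<open>Column \<open>j\<close> evaluates X^(n-1-j) (1 + bX)^j, which has degree below
  \<open>n\<close> and lowest term X^(n-1-j). The coefficient matrix is therefore unitriangular, and
  \<open>b\<close> drops out.\<close>

lemma alternant_empty: "alternant b empty_partition n = vandermonde n"
proof -
  define p :: "nat \<Rightarrow> 'a mps poly" where "p j = monom 1 (n - Suc j) * [:1, Const b:] ^ j" for j
  have "degree ([:1, Const b:] ^ j) \<le> j" for j
    by (rule order_trans[OF degree_power_le]) auto
  then have deg: "degree (p j) < n" if "j < n" for j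
  proof -
    have "degree (p j) \<le> degree (monom (1 :: 'a mps) (n - Suc j)) + degree ([:1, Const b:] ^ j)"
      unfolding p_def by (rule degree_mult_le)
    also have "\<dots> \<le> (n - Suc j) + j"
      by (intro add_mono degree_monom_le) fact
    also have "\<dots> < n" using that by simp
    finally show ?thesis .
  qed
  have zero: "poly.coeff ([:1, Const b:] ^ j) 0 = 1" for j
    by (simp add: poly_0_coeff_0[symmetric])
  then have one: "poly.coeff (p j) (n - Suc j) = 1" for j
    by (simp add: p_def coeff_monom_mult[of 1])
  have "alternant b empty_partition n = det (mat n n (\<lambda>(i, j). poly (p j) (Var i)))"
    by (simp add: alternant_def p_def poly_monom poly_power mult.commute)
  also have "\<dots> = det (mat n n (\<lambda>(i, j). Var i ^ (n - Suc j))) * det (mat n n (\<lambda>(l, j). poly.coeff (p j) (n - Suc l)))"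
    by (rule det_mat_poly) (use deg in auto)
  also have "det (mat n n (\<lambda>(l, j). poly.coeff (p j) (n - Suc l))) = 1"
    by (subst det_mat_upper) (auto simp: zero p_def coeff_monom_mult)
  finally show ?thesis by (simp add: vandermonde_det)
qed

text \<open>The parts decrease weakly, so the indices of the nonzero ones form an initial segment,
  whose cardinality is its bound.\<close>

lemma part_eq_0_iff: "part la i = 0 \<longleftrightarrow> plength la \<le> i"
proof -
  have anti: "antimono (part la)" and fin: "finite {i. part la i \<noteq> 0}" using part[of la] by auto
  have dc: "part la j \<noteq> 0" if "part la i \<noteq> 0" "j \<le> i" for i j
    using antimonoD[OF anti \<open>j \<le> i\<close>] that by auto
  obtain m where m: "{i. part la i \<noteq> 0} = {..<m}"
  proof (cases "{i. part la i \<noteq> 0} = {}")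
    case False
    have "{i. part la i \<noteq> 0} = {..<Suc (Max {i. part la i \<noteq> 0})}"
    proof (intro equalityI subsetI)
      show "i \<in> {..<Suc (Max {i. part la i \<noteq> 0})}" if "i \<in> {i. part la i \<noteq> 0}" for i
        using Max_ge[OF fin that] by simp
      show "i \<in> {i. part la i \<noteq> 0}" if "i \<in> {..<Suc (Max {i. part la i \<noteq> 0})}" for i
        using Max_in[OF fin False] dc[of "Max {i. part la i \<noteq> 0}" i] that by simp
    qed
    then show ?thesis by (rule that)
  qed (use that[of 0] in auto)
  then have "plength la = m" by (simp add: plength_def)
  then show ?thesis using m by (metis (mono_tags, lifting) lessThan_iff mem_Collect_eq not_le)
qed

lemma part_antimono: "i \<le> j \<Longrightarrow> part la j \<le> part la i"
  using part[of la] by (auto dest: antimonoD)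

lemma partition_eqI: "(\<And>i. part la i = part mu i) \<Longrightarrow> la = mu"
  by (metis ext part_inject)

text \<open>With x_n = 0 the last row becomes (0, ..., 0, 1); the 1 is 0^0 and needs the part with
  index \<open>n\<close> to vanish. Each remaining row \<open>i\<close> then has a factor
  \<open>Var i\<close>. The extra factor does not depend on the partition.\<close>

lemma restrict_alternant_Suc:
  assumes "plength la \<le> n"
  shows "restrict_vars n (alternant b la (Suc n)) = (\<Prod>i<n. Var i) * alternant b la n"
proof -
  have "restrict_vars n (alternant b la (Suc n)) = det (mat (Suc n) (Suc n) (\<lambda>(i, j).
      restrict_vars n (Var i ^ (part la j + (n - j)) * (1 + Const b * Var i) ^ j)))"
    unfolding alternant_def by (subst restrict.hom_det_mat) simp
  also have "\<dots> = det (mat n n (\<lambda>(i, j).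
      restrict_vars n (Var i ^ (part la j + (n - j)) * (1 + Const b * Var i) ^ j)))"
    by (rule det_mat_last_row)
       (use assms in \<open>auto simp: restrict.hom_mult restrict.hom_power restrict_Var restrict.hom_add part_eq_0_iff[THEN iffD2] intro!: zero_power\<close>)
  also have "mat n n (\<lambda>(i, j).
      restrict_vars n (Var i ^ (part la j + (n - j)) * (1 + Const b * Var i) ^ j))
     = mat n n (\<lambda>(i, j). Var i * (Var i ^ (part la j + (n - Suc j)) * (1 + Const b * Var i) ^ j))"
    by (rule eq_matI) (auto simp: restrict.hom_mult restrict.hom_power restrict_Var restrict.hom_add
        Suc_diff_Suc mult.assoc[symmetric] simp flip: power_Suc)
  also have "det \<dots> = (\<Prod>i<n. Var i) * alternant b la n"
    unfolding alternant_def by (rule det_mat_mult_rows)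
  finally show ?thesis .
qed

lemma restrict_alternant [simp]: "restrict_vars n (alternant b la n) = alternant b la n"
proof -
  have "restrict_vars n (alternant b la n) = det (mat n n (\<lambda>(i, j).
      restrict_vars n (Var i ^ (part la j + (n - Suc j)) * (1 + Const b * Var i) ^ j)))"
    unfolding alternant_def by (subst restrict.hom_det_mat) simp
  also have "mat n n (\<lambda>(i, j). restrict_vars n (Var i ^ (part la j + (n - Suc j)) * (1 + Const b * Var i) ^ j))
    = mat n n (\<lambda>(i, j). Var i ^ (part la j + (n - Suc j)) * (1 + Const b * Var i) ^ j)"
    by (rule eq_matI) (auto simp: restrict.hom_mult restrict.hom_power restrict_Var restrict.hom_add)
  finally show ?thesis by (simp add: alternant_def)
qed

lemma plength_empty [simp]: "plength empty_partition = 0"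
  by (simp add: plength_def)

lemma restrict_vandermonde [simp]: "restrict_vars n (vandermonde n) = vandermonde n"
  unfolding alternant_empty[of 0, symmetric] by simp

lemma restrict_vandermonde_Suc: "restrict_vars n (vandermonde (Suc n)) = (\<Prod>i<n. Var i) * vandermonde n"
  unfolding alternant_empty[of 0, symmetric] by (rule restrict_alternant_Suc) simp

text \<open>Permuting the variables permutes the rows by the inverse permutation, which has the same
  sign.\<close>

lemma permute_alternant:
  assumes "p permutes {..<n}"
  shows "permute_vars p (alternant b la n) = of_int (sign p) * alternant b la n"
proof -
  have p: "bij p" using assms by (rule permutes_bij)
  interpret comm_ring_hom "permute_vars p :: 'a mps \<Rightarrow> _" by (rule permute_hom[OF p])
  define q where "q = inv_into UNIV p"
  have q: "q permutes {..<n}" unfolding q_def by (rule permutes_inv[OF assms])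
  define A :: "'a mps mat" where "A = mat n n (\<lambda>(i, j). Var i ^ (part la j + (n - Suc j)) * (1 + Const b * Var i) ^ j)"
  have "permute_vars p (alternant b la n) = det (mat n n (\<lambda>(i, j).
      permute_vars p (Var i ^ (part la j + (n - Suc j)) * (1 + Const b * Var i) ^ j)))"
    unfolding alternant_def by (subst hom_det_mat) simp
  also have "mat n n (\<lambda>(i, j). permute_vars p (Var i ^ (part la j + (n - Suc j)) * (1 + Const b * Var i) ^ j))
    = mat n n (\<lambda>(i, j). A $$ (q i, j))"
    using permutes_in_image[OF q]
    by (intro eq_matI) (auto simp: hom_mult hom_power hom_add permute_Var[OF p] permute_Const[OF p] A_def q_def)
  also have "det \<dots> = of_int (sign q) * det A"
    by (rule det_permute_rows) (use q in \<open>auto simp: A_def atLeast0LessThan\<close>)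
  also have "sign q = sign p"
    unfolding q_def by (rule sign_inverse) (use assms permutation_permutes in blast)
  finally show ?thesis by (simp add: A_def alternant_def)
qed

lemma permute_vandermonde:
  assumes "p permutes {..<n}"
  shows "permute_vars p (vandermonde n) = of_int (sign p) * vandermonde n"
  unfolding alternant_empty[of 0, symmetric] by (rule permute_alternant[OF assms])

text \<open>A coefficient of \<open>f\<close> is unchanged when one x_j is traded for x_i, and is
  zero if no x_j is present. Trading away every x_j gives the claim over any commutative
  ring.\<close>

lemma Var_diff_cancel:
  fixes f :: "'a :: comm_ring_1 mps"
  assumes "i \<noteq> j" "(Var i - Var j) * f = 0"
  shows "f = 0"
proof (rule mps_eqI)
  fix M
  have *: "mps_coeff f M = (if j \<in># M then mps_coeff f (add_mset i (M - {#j#})) else 0)" for M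
  proof -
    have "0 = mps_coeff ((Var i - Var j) * f) (add_mset i M)" by (simp add: assms)
    also have "\<dots> = mps_coeff f M - (if j \<in># M then mps_coeff f (add_mset i (M - {#j#})) else 0)"
      using \<open>i \<noteq> j\<close> by (simp add: Var_def left_diff_distrib coeff_mps_monom_mult diff_add_mset_swap)
    finally show ?thesis by simp
  qed
  show "mps_coeff f M = mps_coeff 0 M"
  proof (induction "count M j" arbitrary: M)
    case 0
    then show ?case by (subst *) (auto simp: count_eq_zero_iff)
  next
    case (Suc c)
    then have "mps_coeff f (add_mset i (M - {#j#})) = 0"
      using \<open>i \<noteq> j\<close> by simp
    then show ?case by (subst *) simp
  qed
qed

text \<open>The linear factors are cancelled one at a time. This makes quotients by the Vandermonde
  product unique.\<close>

lemma vandermonde_cancel: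
  fixes f g :: "'a :: comm_ring_1 mps"
  assumes "f * vandermonde n = g * vandermonde n"
  shows "f = g"
proof -
  have *: "finite S \<Longrightarrow> (\<forall>(i, j)\<in>S. i \<noteq> j) \<Longrightarrow> (\<Prod>(i, j)\<in>S. Var i - Var j) * f = 0 \<Longrightarrow> f = 0"
    for S and f :: "'a mps"
  proof (induction S rule: finite_induct)
    case (insert p S)
    obtain i j where "p = (i, j)" by force
    then show ?case
      using insert Var_diff_cancel[of i j "(\<Prod>(i, j)\<in>S. Var i - Var j) * f"] by (auto simp: mult.assoc)
  qed auto
  have "finite {(i, j). i < j \<and> j < n}"
    by (rule finite_subset[of _ "{..<n} \<times> {..<n}"]) auto
  moreover have "\<forall>(i, j)\<in>{(i, j). i < j \<and> j < n}. i \<noteq> j" by auto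
  moreover have "(\<Prod>(i, j) | i < j \<and> j < n. Var i - Var j) * (f - g) = 0"
    using assms by (simp add: vandermonde_def algebra_simps)
  ultimately have "f - g = 0" by (rule *)
  then show ?thesis by simp
qed

section \<open>Complete symmetric functions and the Jacobi--Trudi formula\<close>

lemma coeff_complete: "mps_coeff (complete_sym m) M = (if int (size M) = m then 1 else 0)"
  by (simp add: complete_sym.rep_eq)

lemma complete_neg [simp]: "m < 0 \<Longrightarrow> complete_sym m = (0 :: 'a :: comm_ring_1 mps)"
  by (rule mps_eqI) (auto simp: coeff_complete)

lemma complete_0 [simp]: "complete_sym 0 = (1 :: 'a :: comm_ring_1 mps)"
  by (rule mps_eqI) (auto simp: coeff_complete coeff_one)

lemma restrict_complete_Suc:
  "restrict_vars (Suc n) (complete_sym m)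
    = restrict_vars n (complete_sym m) + Var n * restrict_vars (Suc n) (complete_sym (m - 1) :: 'a :: comm_ring_1 mps)"
proof (rule mps_eqI)
  fix M :: "nat multiset"
  show "mps_coeff (restrict_vars (Suc n) (complete_sym m) :: 'a mps) M
    = mps_coeff (restrict_vars n (complete_sym m) + Var n * restrict_vars (Suc n) (complete_sym (m - 1))) M"
  proof (cases "n \<in># M")
    case True
    then obtain N where "M = add_mset n N" by (metis mset_add)
    then show ?thesis by (auto simp: coeff_restrict coeff_complete Var_def coeff_mps_monom_mult)
  next
    case False
    then have "set_mset M \<subseteq> {..<Suc n} \<longleftrightarrow> set_mset M \<subseteq> {..<n}" by (auto simp: less_Suc_eq subset_iff)
    then show ?thesis using False by (auto simp: coeff_restrict coeff_complete Var_def coeff_mps_monom_mult)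
  qed
qed

text \<open>By the preceding recursion, multiplying the generating series by 1 - x_n t removes the
  variable x_n. Here t is \<open>fps_X\<close>, and the coefficients are themselves series in the
  x_k.\<close>

lemma complete_gen_fun:
  "Abs_fps (\<lambda>m. restrict_vars n (complete_sym (int m))) * (\<Prod>k<n. 1 - fps_const (Var k) * fps_X)
     = (1 :: 'a :: comm_ring_1 mps fps)"
proof (induction n)
  case 0
  show ?case
    by (rule fps_ext) (auto intro!: mps_eqI simp: coeff_restrict coeff_complete coeff_one)
next
  case (Suc n)
  have "Abs_fps (\<lambda>m. restrict_vars (Suc n) (complete_sym (int m))) * (1 - fps_const (Var n) * fps_X)
      = (Abs_fps (\<lambda>m. restrict_vars n (complete_sym (int m))) :: 'a mps fps)"
  proof (rule fps_ext)
    fix m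
    show "fps_nth (Abs_fps (\<lambda>m. restrict_vars (Suc n) (complete_sym (int m))) * (1 - fps_const (Var n) * fps_X)) m
      = fps_nth (Abs_fps (\<lambda>m. restrict_vars n (complete_sym (int m))) :: 'a mps fps) m"
      using restrict_complete_Suc[of n "int m"]
      by (cases m) (simp_all add: right_diff_distrib mult.left_commute[of _ "fps_const _"] diff_eq_eq)
  qed
  note eq = this
  have "(\<Prod>k<Suc n. 1 - fps_const (Var k) * fps_X :: 'a mps fps)
      = (1 - fps_const (Var n) * fps_X) * (\<Prod>k<n. 1 - fps_const (Var k) * fps_X)"
    by (simp add: mult.commute)
  then show ?case
    by (simp only: mult.assoc[symmetric] eq Suc.IH)
qed

lemma fps_prod_linear_nth:
  fixes x :: "nat \<Rightarrow> 'a :: comm_ring_1"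
  assumes "finite S" "card S < m"
  shows "fps_nth (\<Prod>k\<in>S. 1 - fps_const (x k) * fps_X) m = 0"
  using assms
proof (induction S arbitrary: m)
  case (insert a S)
  then obtain m' where "m = Suc m'" by (cases m) auto
  then show ?case using insert by (simp add: left_diff_distrib mult.assoc)
qed auto

text \<open>Coefficient of \<open>t\<^sup>a\<close> in \<open>1 / (1 - x\<^sub>i t) = H(t) \<Prod>\<^sub>k\<^sub>\<noteq>\<^sub>i (1 - x\<^sub>k t)\<close>, where \<open>H\<close> generates the \<open>h\<^sub>m\<close>.\<close>

lemma Var_power_complete:
  fixes n i :: nat
  assumes "i < n"
  defines "q \<equiv> \<Prod>k\<in>{..<n} - {i}. 1 - fps_const (Var k) * fps_X"
  shows "Var i ^ a = (\<Sum>l<n. fps_nth q (n - Suc l) * restrict_vars n (complete_sym (int a - int (n - Suc l)) :: 'a :: comm_ring_1 mps))"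
proof -
  define H where "H = (Abs_fps (\<lambda>m. restrict_vars n (complete_sym (int m))) :: 'a mps fps)"
  have geo: "(1 - fps_const (Var i) * fps_X) * Abs_fps (\<lambda>a. Var i ^ a) = (1 :: 'a mps fps)"
  proof (rule fps_ext)
    fix m show "fps_nth ((1 - fps_const (Var i) * fps_X) * Abs_fps (\<lambda>a. Var i ^ a)) m = fps_nth (1 :: 'a mps fps) m"
      by (cases m) (simp_all add: left_diff_distrib mult.assoc)
  qed
  have "(\<Prod>k<n. 1 - fps_const (Var k) * fps_X) = (1 - fps_const (Var i) * fps_X :: 'a mps fps) * q"
    unfolding q_def using assms by (simp add: prod.remove)
  then have "H * ((1 - fps_const (Var i) * fps_X) * q) = 1"
    using complete_gen_fun[of n, where 'a = 'a] by (simp add: H_def)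
  then have "Abs_fps (\<lambda>a. Var i ^ a) = H * ((1 - fps_const (Var i) * fps_X) * q) * Abs_fps (\<lambda>a. Var i ^ a)"
    by (simp only: mult_1_left)
  also have "\<dots> = (q * H) * ((1 - fps_const (Var i) * fps_X) * Abs_fps (\<lambda>a. Var i ^ a))"
    by (simp only: mult_ac)
  finally have "Abs_fps (\<lambda>a. Var i ^ a) = q * H"
    by (simp only: geo mult_1_right)
  then have "Var i ^ a = fps_nth (q * H) a" by (metis fps_nth_Abs_fps)
  also have "\<dots> = (\<Sum>m\<le>a. fps_nth q m * restrict_vars n (complete_sym (int a - int m)))"
    by (simp add: fps_mult_nth H_def atLeast0AtMost of_nat_diff)
  \<comment> \<open>For \<open>m > a\<close> the complete function has negative degree, and for
    \<open>m \<ge> n\<close> the coefficient of \<open>q\<close> vanishes because \<open>q\<close>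
    has only \<open>n - 1\<close> linear factors.\<close>
  also have "\<dots> = (\<Sum>m<n. fps_nth q m * restrict_vars n (complete_sym (int a - int m)))"
  proof (rule sum.mono_neutral_cong)
    fix m assume "m \<in> {..a} - {..<n}"
    then have "fps_nth q m = 0"
      unfolding q_def using assms by (intro fps_prod_linear_nth) auto
    then show "fps_nth q m * restrict_vars n (complete_sym (int a - int m)) = 0" by simp
  qed auto
  also have "\<dots> = (\<Sum>l<n. fps_nth q (n - Suc l) * restrict_vars n (complete_sym (int a - int (n - Suc l))))"
    by (rule sum.nat_diff_reindex[symmetric])
  finally show ?thesis .
qed

text \<open>Transposed form: the parts index the columns, as they do in
  \<open>alternant\<close>.\<close>

definition jacobi_trudi :: "partition \<Rightarrow> nat \<Rightarrow> 'a :: comm_ring_1 mps" where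
  "jacobi_trudi la n = det (mat n n (\<lambda>(i, j). complete_sym (int (part la j) - int j + int i)))"

text \<open>By \<open>Var_power_complete\<close> the alternant matrix factors through the
  Jacobi-Trudi matrix, and the determinant \<open>Q\<close> of the other factor is the same for all
  partitions. The empty partition identifies \<open>Q\<close> as the Vandermonde product.\<close>

lemma jacobi_trudi_alternant:
  "restrict_vars n (jacobi_trudi la n) * vandermonde n = alternant (0 :: 'a :: comm_ring_1) la n"
proof -
  define q :: "nat \<Rightarrow> 'a mps fps" where "q i = (\<Prod>k\<in>{..<n} - {i}. 1 - fps_const (Var k) * fps_X)" for i
  define Q where "Q = det (mat n n (\<lambda>(i, l). fps_nth (q i) (n - Suc l)))"
  have *: "alternant 0 la n = Q * restrict_vars n (jacobi_trudi la n)" for la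
  proof -
    have "mat n n (\<lambda>(i, j). Var i ^ (part la j + (n - Suc j)) * (1 + Const 0 * Var i) ^ j)
       = mat n n (\<lambda>(i, j). \<Sum>l<n. fps_nth (q i) (n - Suc l) *
           restrict_vars n (complete_sym (int (part la j) - int j + int l) :: 'a mps))"
    proof (rule eq_matI)
      fix i j
      assume "i < dim_row (mat n n (\<lambda>(i, j). \<Sum>l<n. fps_nth (q i) (n - Suc l) *
           restrict_vars n (complete_sym (int (part la j) - int j + int l) :: 'a mps)))"
        "j < dim_col (mat n n (\<lambda>(i, j). \<Sum>l<n. fps_nth (q i) (n - Suc l) *
           restrict_vars n (complete_sym (int (part la j) - int j + int l) :: 'a mps)))"
      then have ij: "i < n" "j < n" by auto
      have "int (part la j + (n - Suc j)) - int (n - Suc l) = int (part la j) - int j + int l" if "l < n" for l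
        using that ij by linarith
      then have "(\<Sum>l<n. fps_nth (q i) (n - Suc l) * restrict_vars n (complete_sym (int (part la j + (n - Suc j)) - int (n - Suc l)) :: 'a mps))
         = (\<Sum>l<n. fps_nth (q i) (n - Suc l) * restrict_vars n (complete_sym (int (part la j) - int j + int l)))"
        by (intro sum.cong refl) (simp only: lessThan_iff)
      then show "mat n n (\<lambda>(i, j). Var i ^ (part la j + (n - Suc j)) * (1 + Const 0 * Var i) ^ j) $$ (i, j)
       = mat n n (\<lambda>(i, j). \<Sum>l<n. fps_nth (q i) (n - Suc l) *
           restrict_vars n (complete_sym (int (part la j) - int j + int l) :: 'a mps)) $$ (i, j)"
        using ij Var_power_complete[OF ij(1), of "part la j + (n - Suc j)", where 'a = 'a]
        by (simp only: q_def[symmetric]) simp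
    qed auto
    then show ?thesis
      unfolding alternant_def Q_def jacobi_trudi_def by (simp add: det_mat_mult restrict.hom_det_mat)
  qed
  \<comment> \<open>Unitriangular, because entries above the diagonal have negative degree.\<close>
  have "jacobi_trudi empty_partition n = (1 :: 'a mps)"
    unfolding jacobi_trudi_def by (subst det_mat_lower) auto
  with *[of empty_partition] have "Q = vandermonde n" by (simp add: alternant_empty)
  then show ?thesis using *[of la] by (simp add: mult.commute)
qed

lemma jacobi_trudi_stable:
  assumes "plength la \<le> n"
  shows "jacobi_trudi la n = (jacobi_trudi la (plength la) :: 'a :: comm_ring_1 mps)"
  using assms
proof (induction rule: dec_induct)
  case (step n)
  have "jacobi_trudi la (Suc n) = (jacobi_trudi la n :: 'a mps)"
    unfolding jacobi_trudi_def
    by (rule det_mat_last_column) (use step in \<open>auto simp: part_eq_0_iff[THEN iffD2]\<close>)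
  then show ?case using step by simp
qed simp

section \<open>Symmetric series\<close>

text \<open>Invariance is separated from bounded degree because stable Grothendieck series are in
  general of unbounded degree.\<close>

definition symmetric :: "'a mps \<Rightarrow> bool" where
  "symmetric f \<longleftrightarrow> (\<forall>\<sigma>. bij \<sigma> \<longrightarrow> permute_vars \<sigma> f = f)"

lemma symmetricD: "symmetric f \<Longrightarrow> bij \<sigma> \<Longrightarrow> permute_vars \<sigma> f = f"
  by (simp add: symmetric_def)

lemma symmetric_hom:
  assumes "symmetric f" "symmetric g"
  shows "symmetric (f + g)" "symmetric (f - g)" "symmetric (f * g)"
proof -
  have "permute_vars \<sigma> (f + g) = f + g" "permute_vars \<sigma> (f - g) = f - g" "permute_vars \<sigma> (f * g) = f * g"
    if "bij \<sigma>" for \<sigma>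
  proof -
    interpret comm_ring_hom "permute_vars \<sigma> :: 'a mps \<Rightarrow> _" by (rule permute_hom[OF that])
    show "permute_vars \<sigma> (f + g) = f + g" "permute_vars \<sigma> (f - g) = f - g" "permute_vars \<sigma> (f * g) = f * g"
      using assms that by (simp_all add: hom_distribs symmetricD)
  qed
  then show "symmetric (f + g)" "symmetric (f - g)" "symmetric (f * g)"
    by (auto simp: symmetric_def)
qed

lemma symmetric_Const [simp]: "symmetric (Const c)"
  by (simp add: symmetric_def permute_Const)

section \<open>Bounded degree, and closure properties of symmetric functions\<close>

definition bounded_degree :: "'a :: zero mps \<Rightarrow> bool" where
  "bounded_degree f \<longleftrightarrow> (\<exists>d. \<forall>M. mps_coeff f M \<noteq> 0 \<longrightarrow> size M \<le> d)"

lemma bounded_degree_add: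
  fixes f g :: "'a :: comm_ring_1 mps"
  assumes "bounded_degree f" "bounded_degree g"
  shows "bounded_degree (f + g)"
proof -
  obtain d e where "mps_coeff f M \<noteq> 0 \<Longrightarrow> size M \<le> d" "mps_coeff g M \<noteq> 0 \<Longrightarrow> size M \<le> e" for M
    using assms unfolding bounded_degree_def by metis
  then have "mps_coeff (f + g) M \<noteq> 0 \<Longrightarrow> size M \<le> max d e" for M
    by (metis add.right_neutral coeff_plus max.coboundedI1 max.coboundedI2)
  then show ?thesis unfolding bounded_degree_def by blast
qed

lemma coeff_mult_nonzeroE:
  assumes "mps_coeff (f * g) M \<noteq> 0"
  obtains A B where "M = A + B" "mps_coeff f A \<noteq> 0" "mps_coeff g B \<noteq> 0"
proof -
  have "\<exists>p\<in>{(A, B). A + B = M}. (case p of (A, B) \<Rightarrow> mps_coeff f A * mps_coeff g B) \<noteq> 0"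
    using assms unfolding coeff_mult by (rule contrapos_np) (auto intro!: sum.neutral)
  then show ?thesis using that by force
qed

lemma bounded_degree_mult:
  fixes f g :: "'a :: comm_ring_1 mps"
  assumes "bounded_degree f" "bounded_degree g"
  shows "bounded_degree (f * g)"
proof -
  obtain d e where "mps_coeff f M \<noteq> 0 \<Longrightarrow> size M \<le> d" "mps_coeff g M \<noteq> 0 \<Longrightarrow> size M \<le> e" for M
    using assms unfolding bounded_degree_def by metis
  then have "mps_coeff (f * g) M \<noteq> 0 \<Longrightarrow> size M \<le> d + e" for M
    by (elim coeff_mult_nonzeroE) (auto intro: add_mono)
  then show ?thesis unfolding bounded_degree_def by blast
qed

lemma bounded_degree_Const [simp]: "bounded_degree (Const c)"
  by (auto simp: bounded_degree_def coeff_Const split: if_splits)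

lemma bounded_degree_of_int [simp]: "bounded_degree (of_int k :: 'a :: comm_ring_1 mps)"
  using bounded_degree_Const[of "of_int k :: 'a"] by (simp add: Const.hom_of_int)

lemma bounded_degree_0 [simp]: "bounded_degree (0 :: 'a :: comm_ring_1 mps)"
  and bounded_degree_1 [simp]: "bounded_degree (1 :: 'a :: comm_ring_1 mps)"
  using bounded_degree_of_int[of 0] bounded_degree_of_int[of 1] by simp_all

lemma bounded_degree_Var [simp]: "bounded_degree (Var i)"
  unfolding bounded_degree_def Var_def coeff_mps_monom by (rule exI[of _ 1]) auto

lemma bounded_degree_sum:
  "(\<And>i. i \<in> S \<Longrightarrow> bounded_degree (f i)) \<Longrightarrow> bounded_degree (sum f S :: 'a :: comm_ring_1 mps)"
  by (induction S rule: infinite_finite_induct) (auto intro: bounded_degree_add)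

lemma bounded_degree_prod:
  "(\<And>i. i \<in> S \<Longrightarrow> bounded_degree (f i)) \<Longrightarrow> bounded_degree (prod f S :: 'a :: comm_ring_1 mps)"
  by (induction S rule: infinite_finite_induct) (auto intro: bounded_degree_mult)

lemma bounded_degree_power: "bounded_degree f \<Longrightarrow> bounded_degree (f ^ n :: 'a :: comm_ring_1 mps)"
  by (induction n) (auto intro: bounded_degree_mult)

lemma bounded_degree_alternant: "bounded_degree (alternant b la n)"
  unfolding alternant_def det_mat_permutes_expand
  by (intro bounded_degree_sum bounded_degree_mult bounded_degree_prod bounded_degree_power
      bounded_degree_add) auto

lemma symmetric_functions_iff:
  "f \<in> symmetric_functions \<longleftrightarrow> symmetric f \<and> bounded_degree f"
proof -
  have "permute_vars \<sigma> f = f \<longleftrightarrow> (\<forall>M. mps_coeff f (image_mset \<sigma> M) = mps_coeff f M)" for \<sigma>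
    by (metis coeff_permute mps_eqI)
  then show ?thesis by (auto simp: symmetric_functions_def symmetric_def bounded_degree_def)
qed

lemma symmetric_functions_symmetric: "f \<in> symmetric_functions \<Longrightarrow> symmetric f"
  by (simp add: symmetric_functions_iff)

lemma symmetric_functions_add:
  "f \<in> symmetric_functions \<Longrightarrow> g \<in> symmetric_functions \<Longrightarrow> f + g \<in> symmetric_functions"
  by (simp add: symmetric_functions_iff symmetric_hom bounded_degree_add)

lemma symmetric_functions_mult:
  "f \<in> symmetric_functions \<Longrightarrow> g \<in> symmetric_functions \<Longrightarrow> f * g \<in> symmetric_functions"
  by (simp add: symmetric_functions_iff symmetric_hom bounded_degree_mult)

lemma symmetric_functions_Const [simp]: "Const c \<in> symmetric_functions"
  by (simp add: symmetric_functions_iff)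

lemma symmetric_functions_of_int [simp]: "of_int k \<in> symmetric_functions"
  using symmetric_functions_Const[of "of_int k"] by (simp add: Const.hom_of_int)

lemma symmetric_functions_0 [simp]: "0 \<in> symmetric_functions"
  and symmetric_functions_1 [simp]: "1 \<in> symmetric_functions"
  using symmetric_functions_of_int[of 0] symmetric_functions_of_int[of 1] by simp_all

lemma symmetric_functions_diff:
  assumes "f \<in> symmetric_functions" "g \<in> symmetric_functions"
  shows "f - g \<in> symmetric_functions"
  using symmetric_functions_add[OF assms(1) symmetric_functions_mult[OF symmetric_functions_of_int[of "-1"] assms(2)]]
  by simp

lemma symmetric_functions_sum:
  "(\<And>i. i \<in> S \<Longrightarrow> f i \<in> symmetric_functions) \<Longrightarrow> sum f S \<in> symmetric_functions"
  by (induction S rule: infinite_finite_induct) (auto intro: symmetric_functions_add)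

lemma symmetric_functions_prod:
  "(\<And>i. i \<in> S \<Longrightarrow> f i \<in> symmetric_functions) \<Longrightarrow> prod f S \<in> symmetric_functions"
  by (induction S rule: infinite_finite_induct) (auto intro: symmetric_functions_mult)

lemma symmetric_functions_det:
  assumes "\<And>i j. i < n \<Longrightarrow> j < n \<Longrightarrow> f i j \<in> symmetric_functions"
  shows "det (mat n n (\<lambda>(i, j). f i j)) \<in> symmetric_functions"
  unfolding det_mat_permutes_expand
proof (intro symmetric_functions_sum symmetric_functions_mult symmetric_functions_prod symmetric_functions_of_int)
  fix p i assume "p \<in> {p. p permutes {..<n}}" "i \<in> {..<n}"
  then show "f i (p i) \<in> symmetric_functions"
    using permutes_in_image[of p "{..<n}" i] assms by auto
qed

lemma symmetric_functions_complete [simp]: "complete_sym m \<in> symmetric_functions"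
  unfolding symmetric_functions_def
  by (auto simp: coeff_complete intro!: exI[of _ "nat m"])

section \<open>Homogeneity and the sizes of partitions\<close>

definition homogeneous :: "int \<Rightarrow> 'a :: zero mps \<Rightarrow> bool" where
  "homogeneous d f \<longleftrightarrow> (\<forall>M. mps_coeff f M \<noteq> 0 \<longrightarrow> int (size M) = d)"

lemma homogeneous_mult: "homogeneous d f \<Longrightarrow> homogeneous e g \<Longrightarrow> homogeneous (d + e) (f * g)"
  unfolding homogeneous_def by (intro allI impI, elim coeff_mult_nonzeroE) auto

lemma homogeneous_prod:
  "(\<And>i. i \<in> S \<Longrightarrow> homogeneous (d i) (f i)) \<Longrightarrow> homogeneous (\<Sum>i\<in>S. d i) (\<Prod>i\<in>S. f i)"
proof (induction S rule: infinite_finite_induct)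
  case (insert i S)
  then show ?case by (simp add: homogeneous_mult)
qed (auto simp: homogeneous_def coeff_one split: if_splits)

text \<open>A permutation reorders the column weights without changing their sum, so all Leibniz
  terms have the same degree. Weights are integers since those of the Jacobi-Trudi columns can be
  negative.\<close>

lemma homogeneous_det:
  assumes "\<And>i j. i < n \<Longrightarrow> j < n \<Longrightarrow> homogeneous (d i + e j) (f i j)"
  shows "homogeneous ((\<Sum>i<n. d i) + (\<Sum>i<n. e i)) (det (mat n n (\<lambda>(i, j). f i j)))"
proof -
  have "homogeneous ((\<Sum>i<n. d i) + (\<Sum>i<n. e i)) (\<Prod>i<n. f i (p i))" if "p permutes {..<n}" for p
  proof -
    have "homogeneous (\<Sum>i<n. d i + e (p i)) (\<Prod>i<n. f i (p i))"
      using permutes_in_image[OF that] by (intro homogeneous_prod assms) auto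
    moreover have "(\<Sum>i<n. e (p i)) = (\<Sum>i<n. e i)"
      using sum.permute[OF that, of e] by (simp add: o_def)
    ultimately show ?thesis by (simp add: sum.distrib)
  qed
  then have *: "mps_coeff (of_int (sign p) * (\<Prod>i<n. f i (p i))) M \<noteq> 0 \<Longrightarrow> int (size M) = (\<Sum>i<n. d i) + (\<Sum>i<n. e i)"
    if "p permutes {..<n}" for p M
    using that unfolding homogeneous_def coeff_of_int_mult by (metis mult_zero_right)
  show ?thesis
    unfolding det_mat_permutes_expand homogeneous_def coeff_sum
    by (auto elim!: sum.not_neutral_contains_not_neutral simp del: coeff_of_int_mult intro: *)
qed

definition psize :: "partition \<Rightarrow> nat" where
  "psize la = (\<Sum>i<plength la. part la i)"

lemma psize_eq: "plength la \<le> n \<Longrightarrow> (\<Sum>i<n. part la i) = psize la"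
  unfolding psize_def by (rule sum.mono_neutral_right) (auto simp: part_eq_0_iff)

lemma plength_le_psize: "plength la \<le> psize la"
proof -
  have "(\<Sum>i<plength la. 1) \<le> (\<Sum>i<plength la. part la i)"
    using part_eq_0_iff by (intro sum_mono) (metis lessThan_iff less_one not_le)
  then show ?thesis by (simp add: psize_def)
qed

text \<open>A partition of size at most \<open>d\<close> has at most \<open>d\<close> nonzero parts,
  each at most \<open>d\<close>, so its first \<open>d\<close> parts determine it and range over a
  finite set.\<close>

lemma finite_partitions: "finite {la. psize la \<le> d}"
proof -
  have "inj_on (\<lambda>la. restrict (part la) {..<d}) {la. psize la \<le> d}"
  proof (rule inj_onI)
    fix la mu
    assume *: "la \<in> {la. psize la \<le> d}" "mu \<in> {la. psize la \<le> d}"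
      "restrict (part la) {..<d} = restrict (part mu) {..<d}"
    show "la = mu"
    proof (rule partition_eqI)
      fix i
      show "part la i = part mu i"
      proof (cases "i < d")
        case True
        then show ?thesis using fun_cong[OF *(3), of i] by simp
      next
        case False
        then have "plength la \<le> i" "plength mu \<le> i"
          using * plength_le_psize[of la] plength_le_psize[of mu] by auto
        then show ?thesis by (simp add: part_eq_0_iff[THEN iffD2])
      qed
    qed
  qed
  moreover have "(\<lambda>la. restrict (part la) {..<d}) ` {la. psize la \<le> d} \<subseteq> PiE {..<d} (\<lambda>_. {..d})"
  proof clarify
    fix la assume la: "psize la \<le> d"
    have "part la i \<le> psize la" for i
    proof (cases "i < plength la")
      case True
      then show ?thesis unfolding psize_def by (intro member_le_sum) auto
    qed (simp add: part_eq_0_iff[THEN iffD2])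
    then show "restrict (part la) {..<d} \<in> PiE {..<d} (\<lambda>_. {..d})"
      using la by (auto intro: order_trans)
  qed
  ultimately show ?thesis
    by (meson finite_PiE finite_atMost finite_lessThan finite_imageD finite_subset)
qed

lemma homogeneous_jacobi_trudi:
  assumes "plength la \<le> n"
  shows "homogeneous (int (psize la)) (jacobi_trudi la n)"
proof -
  have "homogeneous ((\<Sum>i<n. int i) + (\<Sum>i<n. int (part la i) - int i)) (jacobi_trudi la n :: 'a mps)"
    unfolding jacobi_trudi_def
    by (rule homogeneous_det) (auto simp: homogeneous_def coeff_complete)
  then show ?thesis using psize_eq[OF assms] by (simp add: sum_subtractf flip: of_nat_sum)
qed

lemma homogeneous_vandermonde: "homogeneous (\<Sum>i<n. int (n - Suc i)) (vandermonde n)"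
proof -
  have "homogeneous ((\<Sum>i<n. 0) + (\<Sum>i<n. int (n - Suc i))) (vandermonde n :: 'a mps)"
    unfolding vandermonde_det
    by (rule homogeneous_det) (auto simp: homogeneous_def Var_power coeff_mps_monom split: if_splits)
  then show ?thesis by simp
qed

section \<open>Schur functions\<close>

text \<open>Existence comes from the Jacobi-Trudi determinant, uniqueness from cancelling the
  Vandermonde product for all large numbers of variables.\<close>

lemma schur_jacobi_trudi:
  "schur la = jacobi_trudi la (plength la)"
  unfolding schur_def
proof (rule the_equality, intro conjI allI impI)
  show "jacobi_trudi la (plength la) \<in> symmetric_functions"
    unfolding jacobi_trudi_def by (intro symmetric_functions_det) auto
  have alt: "alternant 0 la n = det (mat n n (\<lambda>(i, j). Var i ^ (part la j + (n - Suc j))))" for n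
    by (simp add: alternant_def)
  show *: "restrict_vars n (jacobi_trudi la (plength la)) * vandermonde n =
      det (mat n n (\<lambda>(i, j). Var i ^ (part la j + (n - Suc j))))" if "plength la \<le> n" for n
    unfolding alt[symmetric] jacobi_trudi_alternant[symmetric] jacobi_trudi_stable[OF that] ..
  fix s
  assume s: "s \<in> symmetric_functions \<and> (\<forall>n \<ge> plength la. restrict_vars n s * vandermonde n =
        det (mat n n (\<lambda>(i, j). Var i ^ (part la j + (n - Suc j)))))"
  show "s = jacobi_trudi la (plength la)"
  proof (rule mps_eq_restrictI[of "plength la"])
    fix n assume n: "plength la \<le> n"
    then have "restrict_vars n s * vandermonde n = restrict_vars n (jacobi_trudi la (plength la)) * vandermonde n"
      using s unfolding *[OF n] by blast
    then show "restrict_vars n s = restrict_vars n (jacobi_trudi la (plength la))"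
      by (rule vandermonde_cancel)
  qed
qed

lemma schur_eq: "plength la \<le> n \<Longrightarrow> schur la = jacobi_trudi la n"
  by (simp add: schur_jacobi_trudi jacobi_trudi_stable[of la n])

lemma schur_symmetric_function [simp]: "schur la \<in> symmetric_functions"
  unfolding schur_jacobi_trudi jacobi_trudi_def by (intro symmetric_functions_det) auto

lemma schur_alternant: "plength la \<le> n \<Longrightarrow> restrict_vars n (schur la) * vandermonde n = alternant 0 la n"
  by (simp add: schur_eq jacobi_trudi_alternant)

lemma homogeneous_schur: "homogeneous (int (psize la)) (schur la)"
  unfolding schur_jacobi_trudi by (rule homogeneous_jacobi_trudi) simp

text \<open>The exponent vector \<lambda> + \<delta> for \<open>n\<close> variables, with \<delta> =
  (n-1, ..., 0).\<close>

definition shifted :: "partition \<Rightarrow> nat \<Rightarrow> nat \<Rightarrow> nat" where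
  "shifted la n i = part la i + (n - Suc i)"

abbreviation shifted_mset :: "partition \<Rightarrow> nat \<Rightarrow> nat multiset" where
  "shifted_mset la n \<equiv> expo_mset (shifted la n) n"

lemma shifted_less: "i < j \<Longrightarrow> j < n \<Longrightarrow> shifted la n j < shifted la n i"
  using part_antimono[of i j la] by (simp add: shifted_def)

lemma shifted_less_iff: "i < n \<Longrightarrow> j < n \<Longrightarrow> shifted la n j < shifted la n i \<longleftrightarrow> i < j"
  by (metis shifted_less less_asym linorder_neqE_nat less_irrefl)

lemma alternant_fps:
  "alternant b la n = det (mat n n (\<lambda>(i, j). fps_var i (fps_X ^ shifted la n j * (1 + fps_const b * fps_X) ^ j)))"
  by (simp add: alternant_def shifted_def fps_var.hom_mult fps_var.hom_power fps_var.hom_add)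

lemma coeff_alternant_shifted:
  "mps_coeff (alternant b mu n) (shifted_mset la n)
     = det (mat n n (\<lambda>(i, j). fps_nth (fps_X ^ shifted mu n j * (1 + fps_const b * fps_X) ^ j) (shifted la n i)))"
  unfolding alternant_fps by (rule coeff_expo_mset_det_fps_var)

text \<open>Both shifted sequences are strictly decreasing, so matching them forces \<open>p\<close>
  to be increasing.\<close>

lemma permutes_shifted_id:
  assumes p: "p permutes {..<n}" and eq: "\<And>i. i < n \<Longrightarrow> shifted mu n (p i) = shifted la n i"
  shows "p = id"
proof (rule permutes_natset_ge[OF p], rule ballI)
  have less: "p i < p j" if "i < j" "j < n" for i j
  proof -
    have "p i < n" "p j < n" using permutes_in_image[OF p] that by auto
    then show ?thesis
      using shifted_less[OF that, of la] eq[of i] eq[of j] that shifted_less_iff[of "p i" n "p j" mu] by simp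
  qed
  fix i assume "i \<in> {..<n}"
  then show "i \<le> p i"
  proof (induction i)
    case (Suc i)
    then show ?case using less[of i "Suc i"] by simp
  qed simp
qed

text \<open>At most the identity contributes to the Leibniz expansion. In its uses \<open>P\<close>
  is the equality of two partitions.\<close>

lemma det_mat_delta:
  fixes f :: "nat \<Rightarrow> nat \<Rightarrow> 'a :: comm_ring_1"
  assumes id: "\<And>p. p permutes {..<n} \<Longrightarrow> (\<And>i. i < n \<Longrightarrow> f i (p i) \<noteq> 0) \<Longrightarrow> p = id \<and> P"
    and diag: "\<And>i. P \<Longrightarrow> i < n \<Longrightarrow> f i i = 1"
  shows "det (mat n n (\<lambda>(i, j). f i j)) = (if P then 1 else 0)"
proof -
  have eq: "p = id \<and> P" if p: "p permutes {..<n}" and nz: "(\<Prod>i<n. f i (p i)) \<noteq> 0" for p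
    using nz by (intro id[OF p]) (meson finite_lessThan lessThan_iff prod_zero)
  have "det (mat n n (\<lambda>(i, j). f i j)) = (\<Sum>p\<in>{id}. of_int (sign p) * (\<Prod>i<n. f i (p i)))"
    unfolding det_mat_permutes_expand
    by (rule sum.mono_neutral_right) (auto simp: finite_permutations permutes_id dest: eq)
  also have "\<dots> = (if P then 1 else 0)"
  proof (cases P)
    case True
    then show ?thesis using diag by simp
  next
    case False
    then show ?thesis using eq[of id] by (auto simp: permutes_id)
  qed
  finally show ?thesis .
qed

text \<open>The factors (1 + bx)^j only raise degrees, so a nonzero Leibniz term needs every
  permuted exponent of \<mu> + \<delta> to be at most that of \<lambda> + \<delta>. For
  \<open>b = 0\<close> equality is immediate; otherwise |\<lambda>| \<le> |\<mu>| forces it by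
  comparing sums.\<close>

lemma coeff_alternant_delta:
  assumes "plength la \<le> n" "plength mu \<le> n" and "b = 0 \<or> psize la \<le> psize mu"
  shows "mps_coeff (alternant b mu n) (shifted_mset la n) = (if la = mu then 1 else 0)"
proof -
  define f where "f i j = fps_nth (fps_X ^ shifted mu n j * (1 + fps_const b * fps_X) ^ j) (shifted la n i)" for i j
  have eq: "p = id \<and> la = mu" if p: "p permutes {..<n}" and nz: "\<And>i. i < n \<Longrightarrow> f i (p i) \<noteq> 0" for p
  proof -
    have le: "shifted mu n (p i) \<le> shifted la n i" if "i < n" for i
      using that[THEN nz] unfolding f_def fps_X_power_mult_nth by (simp split: if_splits)
    have shifted_eq: "shifted mu n (p i) = shifted la n i" if "i < n" for i
      using assms(3)
    proof
      assume "b = 0"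
      then show ?thesis using nz[OF that] unfolding f_def fps_X_power_mult_nth by (auto split: if_splits)
    next
      assume "psize la \<le> psize mu"
      have "(\<Sum>i<n. shifted mu n (p i)) = (\<Sum>i<n. shifted mu n i)"
        using sum.permute[OF p, of "shifted mu n"] by (simp add: o_def)
      also have "\<dots> \<ge> (\<Sum>i<n. shifted la n i)"
        using \<open>psize la \<le> psize mu\<close> psize_eq[OF assms(1)] psize_eq[OF assms(2)]
        unfolding shifted_def sum.distrib by simp
      finally have ge: "(\<Sum>i<n. shifted la n i) \<le> (\<Sum>i<n. shifted mu n (p i))" .
      show ?thesis
      proof (rule ccontr)
        assume "shifted mu n (p i) \<noteq> shifted la n i"
        then have "(\<Sum>i<n. shifted mu n (p i)) < (\<Sum>i<n. shifted la n i)"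
          using le that by (intro sum_strict_mono_ex1) (auto intro!: bexI[of _ i] simp: le_neq_implies_less)
        with ge show False by simp
      qed
    qed
    then have "p = id" by (rule permutes_shifted_id[OF p])
    moreover have "la = mu"
    proof (rule partition_eqI)
      fix i
      show "part la i = part mu i"
      proof (cases "i < n")
        case True
        then show ?thesis using shifted_eq[of i] \<open>p = id\<close> by (simp add: shifted_def)
      next
        case False
        then show ?thesis using assms by (simp add: part_eq_0_iff[THEN iffD2])
      qed
    qed
    ultimately show ?thesis ..
  qed
  have "mps_coeff (alternant b mu n) (shifted_mset la n) = det (mat n n (\<lambda>(i, j). f i j))"
    unfolding coeff_alternant_shifted f_def ..
  also have "\<dots> = (if la = mu then 1 else 0)"
  proof (rule det_mat_delta)
    have "fps_nth ((1 + fps_const b * fps_X) ^ j) 0 = 1" for j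
      by (simp add: fps_power_zeroth)
    then show "f i i = 1" if "la = mu" for i using that by (simp add: f_def fps_X_power_mult_nth)
  qed (rule eq)
  finally show ?thesis .
qed

section \<open>Antisymmetric series\<close>

text \<open>Holds since 2 is nonzero in the coefficient field. It makes antisymmetric series vanish
  at monomials with two equal exponents.\<close>

lemma coef_neg_self:
  fixes x :: coef
  assumes "x = - x"
  shows "x = 0"
proof -
  have "(2 :: coef) = Fract 2 1"
    using of_nat_fract[of 2, where 'a = "complex poly"] by simp
  moreover have "Fract 2 1 \<noteq> (Fract 0 1 :: coef)" by (simp add: eq_fract)
  ultimately have "(2 :: coef) \<noteq> 0" by (simp add: Zero_fract_def)
  moreover have "2 * x = 0" using assms by (metis mult_2 right_minus)
  ultimately show ?thesis by simp
qed

lemma count_image_mset_inj: "inj f \<Longrightarrow> count (image_mset f M) (f x) = count M x"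
  by (induction M) (auto simp: inj_eq)

definition antisymmetric :: "nat \<Rightarrow> 'a :: comm_ring_1 mps \<Rightarrow> bool" where
  "antisymmetric n f \<longleftrightarrow> (\<forall>p. p permutes {..<n} \<longrightarrow> permute_vars p f = of_int (sign p) * f)"

lemma antisymmetric_alternant: "antisymmetric n (alternant b la n)"
  by (simp add: antisymmetric_def permute_alternant)

lemma antisymmetric_mult_vandermonde:
  assumes "symmetric f"
  shows "antisymmetric n (f * vandermonde n)"
  unfolding antisymmetric_def
proof (intro allI impI)
  fix p assume p: "p permutes {..<n}"
  then have "bij p" by (rule permutes_bij)
  interpret comm_ring_hom "permute_vars p :: 'a mps \<Rightarrow> _" by (rule permute_hom) fact
  show "permute_vars p (f * vandermonde n) = of_int (sign p) * (f * vandermonde n)"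
    using symmetricD[OF assms \<open>bij p\<close>] by (simp add: hom_mult permute_vandermonde[OF p])
qed

lemma coeff_antisymmetric:
  assumes "antisymmetric n f" "p permutes {..<n}"
  shows "mps_coeff f (image_mset p M) = of_int (sign p) * mps_coeff f M"
  using arg_cong[of _ _ "\<lambda>f. mps_coeff f M", OF assms(1)[unfolded antisymmetric_def, rule_format, OF assms(2)]]
  by (simp add: coeff_permute)

lemma antisymmetric_diff:
  assumes "antisymmetric n f" "antisymmetric n g"
  shows "antisymmetric n (f - g)"
  unfolding antisymmetric_def
proof (intro allI impI)
  fix p assume p: "p permutes {..<n}"
  interpret comm_ring_hom "permute_vars p :: 'a mps \<Rightarrow> _" by (rule permute_hom[OF permutes_bij[OF p]])
  show "permute_vars p (f - g) = of_int (sign p) * (f - g)"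
    using assms p by (simp add: antisymmetric_def hom_minus right_diff_distrib)
qed

text \<open>Strictly decreasing exponents dominate (n-1, ..., 0) termwise, and subtracting this
  staircase leaves a partition.\<close>

lemma strictly_decreasing_shifted:
  assumes "set_mset N \<subseteq> {..<n}" and "\<And>i j. i < j \<Longrightarrow> j < n \<Longrightarrow> count N j < count N i"
  shows "\<exists>la. plength la \<le> n \<and> N = shifted_mset la n"
proof -
  define f where "f i = (if i < n then count N i - (n - Suc i) else 0)" for i
  \<comment> \<open>Induction from the last variable backwards: each earlier exponent is larger by
    at least one.\<close>
  have ge: "n - Suc i \<le> count N i" if "i < n" for i
    using that
  proof (induction "n - Suc i" arbitrary: i)
    case (Suc k)
    then have "Suc i < n" "k = n - Suc (Suc i)" by auto
    then have "k \<le> count N (Suc i)" using Suc.hyps(1)[of "Suc i"] by simp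
    then show ?case using assms(2)[of i "Suc i"] \<open>Suc i < n\<close> Suc.hyps(2) by simp
  qed simp
  have step: "f (Suc i) \<le> f i" for i
    using assms(2)[of i "Suc i"] ge[of i] ge[of "Suc i"] unfolding f_def by auto
  then have "antimono f" by (rule decseq_SucI)
  moreover have "finite {i. f i \<noteq> 0}" by (rule finite_subset[of _ "{..<n}"]) (auto simp: f_def)
  ultimately have part: "part (Abs_partition f) = f" by (simp add: Abs_partition_inverse)
  have "part (Abs_partition f) n = 0" by (simp add: part f_def)
  then have "plength (Abs_partition f) \<le> n" by (simp add: part_eq_0_iff)
  moreover have "N = shifted_mset (Abs_partition f) n"
  proof (rule multiset_eqI)
    fix i
    show "count N i = count (shifted_mset (Abs_partition f) n) i"
      using assms(1) ge[of i] by (auto simp: shifted_def part f_def not_in_iff[symmetric])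
  qed
  ultimately show ?thesis by blast
qed

text \<open>If two exponents agree, a transposition fixes the monomial but changes the sign of its
  coefficient. Otherwise sorting the exponents brings the monomial to the form
  x^(\<lambda>+\<delta>), at the cost of a sign.\<close>

lemma antisymmetric_eq_0:
  fixes f :: "coef mps"
  assumes f: "antisymmetric n f"
    and zero: "\<And>la. plength la \<le> n \<Longrightarrow> mps_coeff f (shifted_mset la n) = 0"
    and M: "set_mset M \<subseteq> {..<n}"
  shows "mps_coeff f M = 0"
proof (cases "inj_on (count M) {..<n}")
  case False
  then obtain i j where ij: "i < n" "j < n" "i \<noteq> j" "count M i = count M j"
    by (auto simp: inj_on_def)
  let ?p = "Transposition.transpose i j"
  have p: "?p permutes {..<n}" using ij by (intro permutes_swap_id) auto
  have "image_mset ?p M = M"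
  proof (rule multiset_eqI)
    fix k
    have "count (image_mset ?p M) (?p (?p k)) = count M (?p k)"
      by (rule count_image_mset_inj) (rule inj_transpose)
    also have "\<dots> = count M k" using ij by (auto simp: Transposition.transpose_def)
    finally show "count (image_mset ?p M) k = count M k" by simp
  qed
  then have "mps_coeff f M = - mps_coeff f M"
    using coeff_antisymmetric[OF f p, of M] ij by (simp add: sign_swap_id)
  then show ?thesis by (rule coef_neg_self)
next
  case True
  \<comment> \<open>The number of larger exponents is the position of \<open>i\<close> in decreasing
    order, so \<open>r\<close> is the sorting permutation; beyond the first \<open>n\<close> indices
    it is the identity.\<close>
  define r where "r i = (if i < n then card {k. k < n \<and> count M i < count M k} else i)" for i
  have less: "r j < r i" if "i < n" "j < n" "count M i < count M j" for i j
    using that unfolding r_def by (auto intro!: psubset_card_mono)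
  have r: "r permutes {..<n}"
  proof (rule bij_imp_permutes)
    have "r ` {..<n} \<subseteq> {..<n}"
    proof clarify
      fix i assume "i < n"
      then have "{k. k < n \<and> count M i < count M k} \<subset> {..<n}" by auto
      then have "card {k. k < n \<and> count M i < count M k} < card {..<n}" by (rule psubset_card_mono[rotated]) simp
      then show "r i < n" using \<open>i < n\<close> by (simp add: r_def)
    qed
    moreover have "inj_on r {..<n}"
      using True less by (intro inj_onI) (metis inj_on_eq_iff lessThan_iff less_irrefl linorder_neqE_nat)
    ultimately show "bij_betw r {..<n} {..<n}"
      by (simp add: bij_betw_def endo_inj_surj)
  qed (auto simp: r_def)
  let ?N = "image_mset r M"
  have count: "count ?N (r i) = count M i" for i
    by (rule count_image_mset_inj) (rule permutes_inj[OF r])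
  have "count ?N j < count ?N i" if "i < j" "j < n" for i j
  proof -
    obtain i' j' where eq: "i = r i'" "j = r j'"
      using permutes_surj[OF r] by (meson surjD)
    then have n: "i' < n" "j' < n"
      using permutes_in_image[OF r, of i'] permutes_in_image[OF r, of j'] that by auto
    have "i' \<noteq> j'" using eq \<open>i < j\<close> by auto
    then have "count M i' \<noteq> count M j'" using True n by (auto simp: inj_on_def)
    moreover have "\<not> count M i' < count M j'"
      using less[OF n] \<open>i < j\<close> unfolding eq by linarith
    ultimately have "count M j' < count M i'" by linarith
    then show ?thesis unfolding eq count .
  qed
  moreover have "set_mset ?N \<subseteq> {..<n}"
    using M permutes_in_image[OF r] by auto
  ultimately obtain la where "plength la \<le> n" "?N = shifted_mset la n"
    using strictly_decreasing_shifted[of ?N n] by blast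
  with zero have "of_int (sign r) * mps_coeff f M = 0"
    using coeff_antisymmetric[OF f r, of M] by simp
  then show ?thesis by (auto simp: sign_def split: if_splits)
qed

lemma antisymmetric_eqI:
  fixes f g :: "coef mps"
  assumes "antisymmetric n f" "antisymmetric n g"
    and "\<And>la. plength la \<le> n \<Longrightarrow> mps_coeff f (shifted_mset la n) = mps_coeff g (shifted_mset la n)"
  shows "restrict_vars n f = restrict_vars n g"
proof (rule mps_eqI)
  fix M
  show "mps_coeff (restrict_vars n f) M = mps_coeff (restrict_vars n g) M"
    using antisymmetric_eq_0[OF antisymmetric_diff[OF assms(1,2)], of M] assms(3) by (auto simp: coeff_restrict)
qed

section \<open>Schur expansion of symmetric series\<close>

definition sym_coeff :: "coef mps \<Rightarrow> partition \<Rightarrow> coef" where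
  "sym_coeff F la = mps_coeff (F * vandermonde (plength la)) (shifted_mset la (plength la))"

lemma prod_Var_power: "(\<Prod>i<n. Var i ^ a i) = mps_monom (expo_mset a n) (1 :: 'a :: comm_ring_1)"
  by (induction n)
    (auto simp: expo_mset_def monom_mult_monom Var_power intro: mps_eqI simp: coeff_one coeff_mps_monom)

lemma coeff_mult_restrict:
  assumes "set_mset M \<subseteq> {..<n}"
  shows "mps_coeff (f * g) M = mps_coeff (restrict_vars n f * restrict_vars n g) M"
  using assms by (simp add: coeff_restrict flip: restrict.hom_mult)

text \<open>A further variable does not occur in x^(\<lambda>+\<delta>), since its part is zero.
  Setting it to zero in the larger Vandermonde product leaves the smaller one times x_0 ... x_(n-1),
  and \<delta> grows by one in the same places.\<close>

lemma sym_coeff_eq: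
  assumes "plength la \<le> n"
  shows "mps_coeff (F * vandermonde n) (shifted_mset la n) = sym_coeff F la"
  using assms
proof (induction rule: dec_induct)
  case (step n)
  have zero: "part la n = 0" using step by (simp add: part_eq_0_iff)
  have *: "shifted_mset la (Suc n) = expo_mset (\<lambda>_. 1) n + shifted_mset la n"
    by (rule multiset_eqI) (auto simp: shifted_def zero less_Suc_eq)
  then have set: "set_mset (shifted_mset la (Suc n)) \<subseteq> {..<n}"
    using set_expo_mset[of _ n] by auto
  have "mps_coeff (F * vandermonde (Suc n)) (shifted_mset la (Suc n))
     = mps_coeff ((\<Prod>i<n. Var i ^ 1) * (restrict_vars n F * vandermonde n)) (shifted_mset la (Suc n))"
    by (subst coeff_mult_restrict[OF set]) (simp add: restrict_vandermonde_Suc mult_ac)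
  also have "\<dots> = mps_coeff (restrict_vars n F * restrict_vars n (vandermonde n)) (shifted_mset la n)"
    unfolding prod_Var_power * by (simp add: coeff_mps_monom_mult)
  also have "\<dots> = mps_coeff (F * vandermonde n) (shifted_mset la n)"
    by (rule coeff_mult_restrict[symmetric, OF set_expo_mset])
  finally show ?case using step.IH by simp
qed (simp add: sym_coeff_def)

lemma sym_coeff_add: "sym_coeff (f + g) la = sym_coeff f la + sym_coeff g la"
  by (simp add: sym_coeff_def distrib_right)

lemma sym_coeff_Const_mult: "sym_coeff (Const c * f) la = c * sym_coeff f la"
  by (simp add: sym_coeff_def mult.assoc)

lemma sym_coeff_sum: "sym_coeff (sum f S) la = (\<Sum>i\<in>S. sym_coeff (f i) la)"
  by (simp add: sym_coeff_def sum_distrib_right)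

lemma sym_coeff_restrict:
  assumes "plength la \<le> n"
  shows "sym_coeff f la = mps_coeff (restrict_vars n f * vandermonde n) (shifted_mset la n)"
  unfolding sym_coeff_eq[OF assms, symmetric]
  by (subst coeff_mult_restrict[OF set_expo_mset]) simp

lemma sym_coeff_schur: "sym_coeff (schur ka) la = (if la = ka then 1 else 0)"
proof -
  define n where "n = max (plength la) (plength ka)"
  have n: "plength la \<le> n" "plength ka \<le> n" by (auto simp: n_def)
  then show ?thesis
    by (simp add: sym_coeff_restrict[of la n] schur_alternant coeff_alternant_delta)
qed

lemma coeff_schur_eq_0: "psize la \<noteq> size M \<Longrightarrow> mps_coeff (schur la) M = 0"
  using homogeneous_schur[of la] unfolding homogeneous_def by force

text \<open>Homogeneity leaves only partitions of size \<open>size M\<close>. A common bound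
  \<open>d\<close> gives one finite Schur sum valid for all monomials of degree at most
  \<open>d\<close>.\<close>

lemma coeff_schur_series:
  assumes "size M \<le> d"
  shows "mps_coeff (schur_series c) M = (\<Sum>la | psize la \<le> d. c la * mps_coeff (schur la) M)"
proof -
  have "mps_coeff (schur_series c) M = Sum_any (\<lambda>la. c la * mps_coeff (schur la) M)"
    by (simp add: schur_series_def)
  also have "\<dots> = (\<Sum>la | psize la \<le> d. c la * mps_coeff (schur la) M)"
    by (rule Sum_any.expand_superset) (use assms coeff_schur_eq_0 in \<open>force intro: finite_partitions\<close>)+
  finally show ?thesis .
qed

text \<open>Factors of \<open>M\<close> have at most its degree, so infinite Schur expansions may be
  truncated inside a product.\<close>

lemma coeff_mult_cong:
  assumes "\<And>A. size A \<le> size M \<Longrightarrow> mps_coeff f A = mps_coeff g A"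
  shows "mps_coeff (f * h) M = mps_coeff (g * h) M"
  unfolding coeff_mult by (rule sum.cong) (auto intro!: arg_cong2[of _ _ _ _ "(*)"] assms)

lemma sym_coeff_schur_series [simp]: "sym_coeff (schur_series c) la = c la"
proof -
  let ?M = "shifted_mset la (plength la)"
  define S where "S = {ka. psize ka \<le> size ?M}"
  have "psize la \<le> size ?M"
    using psize_eq[of la "plength la"] unfolding size_expo_mset shifted_def sum.distrib by simp
  then have S: "finite S" "la \<in> S" by (auto simp: S_def finite_partitions)
  have "sym_coeff (schur_series c) la = sym_coeff (\<Sum>ka\<in>S. Const (c ka) * schur ka) la"
    unfolding sym_coeff_def
    by (rule coeff_mult_cong) (simp add: coeff_schur_series[of _ "size ?M"] S_def)
  also have "\<dots> = (\<Sum>ka\<in>S. if la = ka then c ka else 0)"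
    unfolding sym_coeff_sum sym_coeff_Const_mult sym_coeff_schur by (rule sum.cong) auto
  finally show ?thesis using S by simp
qed

lemma symmetric_schur_series: "symmetric (schur_series c)"
  unfolding symmetric_def
proof (intro allI impI mps_eqI)
  fix \<sigma> :: "nat \<Rightarrow> nat" and M assume "bij \<sigma>"
  then have "mps_coeff (schur la) (image_mset \<sigma> M) = mps_coeff (schur la) M" for la
    using symmetricD[OF symmetric_functions_symmetric[OF schur_symmetric_function]] by (metis coeff_permute)
  then show "mps_coeff (permute_vars \<sigma> (schur_series c)) M = mps_coeff (schur_series c) M"
    by (simp add: coeff_permute schur_series_def)
qed

text \<open>This recognizes \<open>F\<close> as the quotient of \<open>A\<close> by the Vandermonde
  product: both sides are antisymmetric, so only the exponents \<lambda> + \<delta> need to be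
  compared.\<close>

lemma symmetric_vandermonde_eqI:
  fixes F :: "coef mps"
  assumes "symmetric F" "antisymmetric n A"
    and "\<And>la. plength la \<le> n \<Longrightarrow> sym_coeff F la = mps_coeff A (shifted_mset la n)"
  shows "restrict_vars n F * vandermonde n = restrict_vars n A"
proof -
  have "restrict_vars n (F * vandermonde n) = restrict_vars n A"
    by (rule antisymmetric_eqI) (use assms sym_coeff_eq in \<open>auto intro: antisymmetric_mult_vandermonde\<close>)
  then show ?thesis by (simp add: restrict.hom_mult)
qed

text \<open>Both series have the same Schur coefficients, hence equal products with the Vandermonde
  product in any number of variables, where it can be cancelled.\<close>

lemma schur_series_sym_coeff:
  assumes "symmetric F"
  shows "schur_series (sym_coeff F) = F"
proof (rule mps_eq_restrictI)
  fix n
  have "restrict_vars n (schur_series (sym_coeff F)) * vandermonde n = restrict_vars n (F * vandermonde n)"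
    by (rule symmetric_vandermonde_eqI)
      (use assms sym_coeff_eq in \<open>auto intro: antisymmetric_mult_vandermonde symmetric_schur_series\<close>)
  also have "\<dots> = restrict_vars n F * vandermonde n" by (simp add: restrict.hom_mult)
  finally show "restrict_vars n (schur_series (sym_coeff F)) = restrict_vars n F"
    by (rule vandermonde_cancel)
qed

lemma symmetric_eqI:
  assumes "symmetric f" "symmetric g" "\<And>la. sym_coeff f la = sym_coeff g la"
  shows "f = g"
  using assms by (metis ext schur_series_sym_coeff)

section \<open>The Hall pairing\<close>

lemma schur_coeff_eq:
  assumes "symmetric F"
  shows "schur_coeff F = sym_coeff F"
  unfolding schur_coeff_def
proof (rule the_equality)
  fix c assume "F = schur_series c"
  then show "c = sym_coeff F" by (auto intro: ext)
qed (simp add: schur_series_sym_coeff assms)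

lemma hall_eq:
  assumes "symmetric F" "symmetric f"
  shows "hall F f = Sum_any (\<lambda>la. sym_coeff F la * sym_coeff f la)"
  by (simp add: hall_def schur_coeff_eq assms)

text \<open>In a factorization of x^(\<lambda>+\<delta>) the Vandermonde part has degree |\<delta>|,
  which leaves degree |\<lambda>| for \<open>f\<close>.\<close>

lemma finite_sym_coeff:
  assumes "f \<in> symmetric_functions"
  shows "finite {la. sym_coeff f la \<noteq> 0}"
proof -
  obtain d where d: "mps_coeff f M \<noteq> 0 \<Longrightarrow> size M \<le> d" for M
    using assms unfolding symmetric_functions_iff bounded_degree_def by metis
  have "psize la \<le> d" if nz: "sym_coeff f la \<noteq> 0" for la
  proof -
    let ?n = "plength la"
    obtain A B where AB: "shifted_mset la ?n = A + B" "mps_coeff f A \<noteq> 0" "mps_coeff (vandermonde ?n :: coef mps) B \<noteq> 0"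
      using nz unfolding sym_coeff_def by (rule coeff_mult_nonzeroE)
    have "int (size B) = (\<Sum>i<?n. int (?n - Suc i))"
      using homogeneous_vandermonde[of ?n, where 'a = coef] AB(3) unfolding homogeneous_def by blast
    then have "size B = (\<Sum>i<?n. ?n - Suc i)" by (metis of_nat_eq_iff of_nat_sum)
    moreover have "size A + size B = psize la + (\<Sum>i<?n. ?n - Suc i)"
      using arg_cong[OF AB(1), of size] psize_eq[of la ?n] unfolding size_expo_mset shifted_def sum.distrib by simp
    ultimately show ?thesis using d[OF AB(2)] by simp
  qed
  then show ?thesis by (intro finite_subset[OF _ finite_partitions[of d]]) auto
qed

text \<open>\<open>c\<close> is arbitrary since the left argument of the pairing may be an infinite
  Schur sum. \<open>Sum_any\<close> is 0 on infinite support, so linearity of the pairing rests on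
  this.\<close>

lemma finite_hall:
  assumes "f \<in> symmetric_functions"
  shows "finite {la. c la * sym_coeff f la \<noteq> 0}"
  by (rule finite_subset[OF _ finite_sym_coeff[OF assms]]) auto

lemma hall_add:
  assumes "symmetric F" "f \<in> symmetric_functions" "g \<in> symmetric_functions"
  shows "hall F (f + g) = hall F f + hall F g"
  unfolding hall_eq[OF assms(1) symmetric_functions_symmetric[OF assms(2)]]
    hall_eq[OF assms(1) symmetric_functions_symmetric[OF assms(3)]]
    hall_eq[OF assms(1) symmetric_functions_symmetric[OF symmetric_functions_add[OF assms(2,3)]]]
    sym_coeff_add distrib_left
  by (rule Sum_any.distrib) (intro finite_hall assms)+

lemma hall_0: "symmetric F \<Longrightarrow> hall F 0 = 0"
  by (simp add: hall_eq symmetric_functions_symmetric sym_coeff_def)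

lemma hall_Const_mult:
  assumes "symmetric F" "f \<in> symmetric_functions"
  shows "hall F (Const c * f) = c * hall F f"
  unfolding hall_eq[OF assms(1) symmetric_functions_symmetric[OF assms(2)]]
    hall_eq[OF assms(1) symmetric_functions_symmetric[OF symmetric_functions_mult[OF symmetric_functions_Const assms(2)]]]
    sym_coeff_Const_mult mult.left_commute[of _ c]
  by (rule Sum_any_right_distrib[symmetric]) (intro finite_hall assms)

lemma hall_diff:
  assumes "symmetric F" "f \<in> symmetric_functions" "g \<in> symmetric_functions"
  shows "hall F (f - g) = hall F f - hall F g"
  using hall_add[OF assms(1) symmetric_functions_diff[OF assms(2,3)] assms(3)] by simp

lemma hall_sum:
  assumes "symmetric F" "\<And>i. i \<in> S \<Longrightarrow> f i \<in> symmetric_functions"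
  shows "hall F (sum f S) = (\<Sum>i\<in>S. hall F (f i))"
  using assms
  by (induction S rule: infinite_finite_induct)
    (auto simp: hall_0 hall_add symmetric_functions_sum)

lemma hall_commute: "symmetric F \<Longrightarrow> symmetric f \<Longrightarrow> hall F f = hall f F"
  by (simp add: hall_eq mult.commute)

lemma hall_schur:
  assumes "symmetric F"
  shows "hall F (schur la) = sym_coeff F la"
proof -
  have "hall F (schur la) = Sum_any (\<lambda>ka. if ka = la then sym_coeff F ka else 0)"
    unfolding hall_eq[OF assms symmetric_functions_symmetric[OF schur_symmetric_function]] sym_coeff_schur
    by (rule arg_cong[of _ _ Sum_any]) auto
  then show ?thesis by simp
qed

section \<open>Duality between complete and monomial symmetric functions\<close>

text \<open>A monomial is split into one monomial per factor. Splittings are functions on all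
  indices, so their components from \<open>n\<close> on are fixed as empty. Finiteness is proved
  along, because the induction needs it to regroup sums.\<close>

lemma coeff_prod:
  fixes f :: "nat \<Rightarrow> 'a :: comm_ring_1 mps"
  shows "finite {m. (\<forall>i\<ge>n. m i = {#}) \<and> (\<Sum>i<n. m i) = M} \<and>
    mps_coeff (\<Prod>i<n. f i) M =
      (\<Sum>m | (\<forall>i\<ge>n. m i = {#}) \<and> (\<Sum>i<n. m i) = M. \<Prod>i<n. mps_coeff (f i) (m i))"
proof (induction n arbitrary: M)
  case 0
  have "{m. (\<forall>i\<ge>0::nat. m i = {#}) \<and> (\<Sum>i<0. m i) = M} = (if M = {#} then {\<lambda>_. {#}} else {})"
    by auto
  then show ?case by (simp add: coeff_one)
next
  case (Suc n)
  let ?S = "\<lambda>n M. {m. (\<forall>i\<ge>n. m i = {#}) \<and> (\<Sum>i<n. m i) = M}"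
  let ?T = "Sigma {(A, B). A + B = M} (\<lambda>p. ?S n (fst p))"
  \<comment> \<open>Mutually inverse maps: \<open>?j\<close> splits off the last component,
    \<open>?i\<close> puts it back.\<close>
  let ?i = "\<lambda>((A, B), m). m(n := B)" and ?j = "\<lambda>m. ((\<Sum>i<n. m i, m n), m(n := {#}))"
  have T: "finite ?T"
    using Suc.IH by (intro finite_SigmaI finite_mset_splits) auto
  have j: "?j m \<in> ?T" "?i (?j m) = m" if "m \<in> ?S (Suc n) M" for m
  proof -
    have "(m(n := {#})) i = {#}" if "n \<le> i" for i
      using \<open>m \<in> ?S (Suc n) M\<close> that by (cases "i = n") auto
    then show "?j m \<in> ?T" using that by auto
  qed auto
  have i: "?i p \<in> ?S (Suc n) M" "?j (?i p) = p" if "p \<in> ?T" for p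
    using that by (auto simp: fun_eq_iff)
  have "?S (Suc n) M \<subseteq> ?i ` ?T"
    using j by (metis (no_types, lifting) imageI subsetI)
  then have fin: "finite (?S (Suc n) M)" by (rule finite_subset) (rule finite_imageI[OF T])
  have "mps_coeff (\<Prod>i<Suc n. f i) M
     = (\<Sum>p\<in>{(A, B). A + B = M}. \<Sum>m\<in>?S n (fst p). (\<Prod>i<n. mps_coeff (f i) (m i)) * mps_coeff (f n) (snd p))"
    using Suc.IH by (simp add: coeff_mult case_prod_beta sum_distrib_right)
  also have "\<dots> = (\<Sum>(p, m)\<in>?T. (\<Prod>i<n. mps_coeff (f i) (m i)) * mps_coeff (f n) (snd p))"
    by (rule sum.Sigma) (use Suc.IH in \<open>auto simp: finite_mset_splits\<close>)
  also have "\<dots> = (\<Sum>m\<in>?S (Suc n) M. \<Prod>i<Suc n. mps_coeff (f i) (m i))"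
    by (rule sum.reindex_bij_witness[of _ ?j ?i]) (use i j in \<open>auto intro!: prod.cong\<close>)
  finally show ?case using fin by simp
qed

text \<open>Row \<open>i\<close> of a matrix of natural numbers is encoded by the multiset \<open>m i\<close> of its column indices.\<close>

definition matrices :: "(nat \<Rightarrow> nat) \<Rightarrow> (nat \<Rightarrow> nat) \<Rightarrow> nat \<Rightarrow> (nat \<Rightarrow> nat multiset) set" where
  "matrices b a n = {m. (\<forall>i\<ge>n. m i = {#}) \<and> (\<forall>i<n. size (m i) = b i) \<and> (\<Sum>i<n. m i) = expo_mset a n}"

text \<open>Every coefficient of a complete function in its own degree is 1, so the product counts
  splittings with prescribed sizes: matrices with row sums \<open>b\<close> and column sums
  \<open>a\<close>.\<close>

lemma coeff_prod_complete:
  "mps_coeff (\<Prod>i<n. complete_sym (int (b i))) (expo_mset a n) = (of_nat (card (matrices b a n)) :: 'a :: comm_ring_1)"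
proof -
  let ?S = "{m. (\<forall>i\<ge>n. m i = {#}) \<and> (\<Sum>i<n. m i) = expo_mset a n}"
  have fin: "finite ?S" using coeff_prod[of n] by blast
  have "(\<Prod>i<n. mps_coeff (complete_sym (int (b i))) (m i)) = (if m \<in> matrices b a n then 1 else 0 :: 'a)"
    if "m \<in> ?S" for m
    using that by (auto simp: matrices_def coeff_complete intro!: prod_zero)
  then have "mps_coeff (\<Prod>i<n. complete_sym (int (b i))) (expo_mset a n) = (\<Sum>m\<in>?S. if m \<in> matrices b a n then 1 else 0 :: 'a)"
    unfolding conjunct2[OF coeff_prod] by (rule sum.cong[OF refl])
  also have "\<dots> = of_nat (card (?S \<inter> matrices b a n))"
    using fin by (simp add: sum.If_cases)
  also have "?S \<inter> matrices b a n = matrices b a n" by (auto simp: matrices_def)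
  finally show ?thesis .
qed

text \<open>\<open>T\<close> is transposition: its row \<open>k\<close> collects the entries of
  column \<open>k\<close>, so row sums and column sums trade places.\<close>

lemma matrices_transpose:
  defines "T \<equiv> \<lambda>n m k. if k < n then expo_mset (\<lambda>i. count (m i) k) n else {#}"
  assumes m: "m \<in> matrices b a n"
  shows "T n m \<in> matrices a b n" "T n (T n m) = m"
proof -
  have col: "(\<Sum>i<n. count (m i) k) = (if k < n then a k else 0)" for k
    using m by (simp add: matrices_def flip: count_sum)
  \<comment> \<open>Columns from \<open>n\<close> on have sum zero, so no such index occurs in any
    row.\<close>
  have set: "set_mset (m i) \<subseteq> {..<n}" for i
  proof (cases "i < n")
    case True
    have "count (m i) k = 0" if "\<not> k < n" for k
      using col[of k] that True by simp
    then show ?thesis by (metis not_in_iff lessThan_iff subsetI)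
  qed (use m in \<open>simp add: matrices_def\<close>)
  have row: "(\<Sum>k<n. count (m i) k) = b i" if "i < n" for i
  proof -
    have "(\<Sum>k<n. count (m i) k) = (\<Sum>k\<in>set_mset (m i). count (m i) k)"
      using set by (intro sum.mono_neutral_right) (auto simp: not_in_iff)
    then show ?thesis
      using m that by (simp add: matrices_def size_multiset_overloaded_eq)
  qed
  show "T n m \<in> matrices a b n"
    unfolding matrices_def
  proof (intro CollectI conjI allI impI)
    show "size (T n m k) = a k" if "k < n" for k
      using that col[of k] by (simp add: T_def size_expo_mset)
    show "(\<Sum>k<n. T n m k) = expo_mset b n"
      by (rule multiset_eqI) (use row in \<open>auto simp: T_def count_sum\<close>)
  qed (simp add: T_def)
  show "T n (T n m) = m"
  proof
    fix i
    show "T n (T n m) i = m i"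
    proof (cases "i < n")
      case True
      have "T n (T n m) i = expo_mset (count (m i)) n"
        using True by (auto simp: T_def intro!: expo_mset_cong)
      then show ?thesis using expo_mset_count[OF set] by simp
    qed (use m in \<open>simp add: T_def matrices_def\<close>)
  qed
qed

lemma card_matrices_commute: "card (matrices b a n) = card (matrices a b n)"
proof -
  let ?T = "\<lambda>m k. if k < n then expo_mset (\<lambda>i. count (m i) k) n else {#}"
  have "bij_betw ?T (matrices b a n) (matrices a b n)"
    by (rule bij_betw_byWitness[of _ ?T]) (use matrices_transpose in auto)
  then show ?thesis by (rule bij_betw_same_card)
qed

lemma coeff_prod_complete_commute:
  "mps_coeff (\<Prod>i<n. complete_sym (int (b i))) (expo_mset a n)
    = (mps_coeff (\<Prod>i<n. complete_sym (int (a i))) (expo_mset b n) :: 'a :: comm_ring_1)"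
  by (simp add: coeff_prod_complete card_matrices_commute[of b])

lemma vandermonde_expand:
  "vandermonde n = (\<Sum>p | p permutes {..<n}. of_int (sign p) * mps_monom (expo_mset (\<lambda>i. n - Suc (p i)) n) (1 :: 'a :: comm_ring_1))"
  unfolding vandermonde_det det_mat_permutes_expand prod_Var_power ..

text \<open>Expanding the Vandermonde product gives a signed sum of coefficients at \<lambda> +
  \<delta> - p(\<delta>). The symmetry \<open>coeff_prod_complete_commute\<close> exchanges these
  exponents with \<open>a\<close>, and a Jacobi-Trudi determinant results.\<close>

lemma sym_coeff_prod_complete_aux:
  assumes n: "plength la \<le> n"
  shows "sym_coeff (\<Prod>i<n. complete_sym (int (a i))) la = mps_coeff (schur la) (expo_mset a n)"
proof -
  let ?P = "\<Prod>i<n. complete_sym (int (a i)) :: coef mps"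
  have *: "mps_coeff (mps_monom (expo_mset (\<lambda>i. n - Suc (p i)) n) 1 * ?P) (shifted_mset la n)
      = mps_coeff (\<Prod>i<n. complete_sym (int (part la i) - int i + int (p i))) (expo_mset a n)"
    if p: "p permutes {..<n}" for p
  proof -
    have p_less: "p i < n" if "i < n" for i using permutes_in_image[OF p] that by auto
    \<comment> \<open>A negative exponent difference, for which the monomial does not divide,
      matches a complete function of negative degree; both sides then vanish.\<close>
    have iff: "n - Suc (p i) \<le> shifted la n i \<longleftrightarrow> 0 \<le> int (part la i) - int i + int (p i)" if "i < n" for i
      using p_less[OF that] that by (auto simp: shifted_def)
    show ?thesis
    proof (cases "\<forall>i<n. n - Suc (p i) \<le> shifted la n i")
      case True
      define b where "b i = shifted la n i - (n - Suc (p i))" for i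
      have b: "int (part la i) - int i + int (p i) = int (b i)" if "i < n" for i
        using True p_less[OF that] that unfolding b_def shifted_def by auto
      have "expo_mset (\<lambda>i. n - Suc (p i)) n \<subseteq># shifted_mset la n"
        using True by (auto simp: subseteq_mset_def)
      moreover have "shifted_mset la n - expo_mset (\<lambda>i. n - Suc (p i)) n = expo_mset b n"
        by (rule multiset_eqI) (auto simp: b_def)
      ultimately have "mps_coeff (mps_monom (expo_mset (\<lambda>i. n - Suc (p i)) n) 1 * ?P) (shifted_mset la n)
          = mps_coeff ?P (expo_mset b n)"
        by (simp add: coeff_mps_monom_mult)
      also have "\<dots> = mps_coeff (\<Prod>i<n. complete_sym (int (b i))) (expo_mset a n)"
        by (rule coeff_prod_complete_commute)
      also have "(\<Prod>i<n. complete_sym (int (b i)) :: coef mps) = (\<Prod>i<n. complete_sym (int (part la i) - int i + int (p i)))"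
        by (rule prod.cong) (auto simp: b)
      finally show ?thesis .
    next
      case False
      then obtain i where i: "i < n" "\<not> n - Suc (p i) \<le> shifted la n i" by blast
      then have "complete_sym (int (part la i) - int i + int (p i)) = (0 :: coef mps)"
        using iff[OF i(1)] by (intro complete_neg) linarith
      then have "(\<Prod>i<n. complete_sym (int (part la i) - int i + int (p i))) = (0 :: coef mps)"
        using i by (intro prod_zero) auto
      moreover have "\<not> expo_mset (\<lambda>i. n - Suc (p i)) n \<subseteq># shifted_mset la n"
        using i by (auto simp: subseteq_mset_def)
      ultimately show ?thesis by (simp add: coeff_mps_monom_mult)
    qed
  qed
  have "sym_coeff ?P la = mps_coeff (vandermonde n * ?P) (shifted_mset la n)"
    unfolding sym_coeff_eq[OF n, symmetric] by (simp add: mult.commute)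
  also have "\<dots> = (\<Sum>p | p permutes {..<n}. of_int (sign p) *
      mps_coeff (mps_monom (expo_mset (\<lambda>i. n - Suc (p i)) n) 1 * ?P) (shifted_mset la n))"
    unfolding vandermonde_expand by (simp add: sum_distrib_right mult.assoc)
  also have "\<dots> = (\<Sum>p | p permutes {..<n}. of_int (sign p) *
      mps_coeff (\<Prod>i<n. complete_sym (int (part la i) - int i + int (p i))) (expo_mset a n))"
    using * by (intro sum.cong) auto
  also have "\<dots> = mps_coeff (jacobi_trudi la n) (expo_mset a n)"
    unfolding jacobi_trudi_def by (subst det_mat_transpose) (simp add: det_mat_permutes_expand)
  finally show ?thesis by (simp add: schur_eq[OF n])
qed

lemma sym_coeff_prod_complete:
  "sym_coeff (\<Prod>i<r. complete_sym (int (a i))) la = mps_coeff (schur la) (expo_mset a r)"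
proof -
  define n where "n = max r (plength la)"
  \<comment> \<open>Padding with factors h_0 = 1 makes their number at least the length of
    \<lambda>.\<close>
  define a' where "a' i = (if i < r then a i else 0)" for i
  have "(\<Prod>i<r. complete_sym (int (a i)) :: coef mps) = (\<Prod>i<n. complete_sym (int (a' i)))"
    by (rule prod.mono_neutral_cong_left) (auto simp: n_def a'_def)
  moreover have "expo_mset a r = expo_mset a' n"
    by (rule multiset_eqI) (auto simp: n_def a'_def)
  ultimately show ?thesis
    using sym_coeff_prod_complete_aux[of la n a'] by (simp add: n_def)
qed

text \<open>The Schur coefficients of the product are the coefficients of x^a in the Schur
  functions, so the pairing adds up to the coefficient of x^a in the Schur expansion of
  \<open>F\<close>.\<close>

lemma hall_prod_complete:
  assumes "symmetric F"
  shows "hall F (\<Prod>i<r. complete_sym (int (a i))) = mps_coeff F (expo_mset a r)"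
proof -
  have "(\<Prod>i<r. complete_sym (int (a i))) \<in> symmetric_functions"
    by (intro symmetric_functions_prod) auto
  then have "hall F (\<Prod>i<r. complete_sym (int (a i))) = mps_coeff (schur_series (sym_coeff F)) (expo_mset a r)"
    using assms by (simp add: hall_eq symmetric_functions_symmetric sym_coeff_prod_complete schur_series_def)
  then show ?thesis by (simp add: schur_series_sym_coeff assms)
qed

text \<open>The coefficient of t^m in u(t) H(t), where H generates the complete symmetric
  functions.\<close>

definition complete_conv :: "coef fps \<Rightarrow> nat \<Rightarrow> coef mps" where
  "complete_conv u m = (\<Sum>k\<le>m. Const (fps_nth u k) * complete_sym (int (m - k)))"

lemma complete_conv_symmetric_function [simp]: "complete_conv u m \<in> symmetric_functions"
  unfolding complete_conv_def by (intro symmetric_functions_sum symmetric_functions_mult) auto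

text \<open>After multiplying out, the vector \<open>k\<close> says which part of x^g the series
  u_i(x_i) supply; the remaining x^(g-k) is read off \<open>F\<close> by duality. This is the
  convolution for a coefficient of the product.\<close>

lemma hall_prod_complete_conv:
  assumes "symmetric F"
  shows "hall F (\<Prod>i<r. complete_conv (u i) (g i)) = mps_coeff (F * (\<Prod>i<r. fps_var i (u i))) (expo_mset g r)"
proof -
  have "(\<Prod>i<r. complete_conv (u i) (g i))
     = (\<Sum>k\<in>PiE {..<r} (\<lambda>i. {..g i}). \<Prod>i<r. Const (fps_nth (u i) (k i)) * complete_sym (int (g i - k i)))"
    unfolding complete_conv_def by (rule prod_sum_PiE) auto
  also have "\<dots> = (\<Sum>k\<in>PiE {..<r} (\<lambda>i. {..g i}). Const (\<Prod>i<r. fps_nth (u i) (k i)) * (\<Prod>i<r. complete_sym (int (g i - k i))))"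
    by (simp add: prod.distrib Const.hom_prod)
  finally have "hall F (\<Prod>i<r. complete_conv (u i) (g i))
     = (\<Sum>k\<in>PiE {..<r} (\<lambda>i. {..g i}). (\<Prod>i<r. fps_nth (u i) (k i)) * mps_coeff F (expo_mset (\<lambda>i. g i - k i) r))"
    using assms
    by (simp add: hall_sum hall_Const_mult hall_prod_complete symmetric_functions_mult symmetric_functions_prod)
  also have "\<dots> = (\<Sum>(A, B) | A + B = expo_mset g r. mps_coeff F A * mps_coeff (\<Prod>i<r. fps_var i (u i)) B)"
  \<comment> \<open>\<open>k\<close> corresponds to the splitting of x^g into x^(g-k) and x^k;
    \<open>restrict\<close> recovers it as an extensional function.\<close>
  proof (rule sum.reindex_bij_witness
      [of _ "\<lambda>(A, B). restrict (count B) {..<r}" "\<lambda>k. (expo_mset (\<lambda>i. g i - k i) r, expo_mset k r)"], goal_cases)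
    case (1 k)
    have "restrict (count (expo_mset k r)) {..<r} i = k i" for i
      using PiE_arb[OF 1, of i] by (cases "i < r") simp_all
    then show ?case by (simp only: prod.case) (rule ext)
  next
    case (2 k)
    have "k i \<le> g i" if "i < r" for i
      using PiE_mem[OF 2, of i] that by simp
    then have "expo_mset (\<lambda>i. g i - k i) r + expo_mset k r = expo_mset g r"
      by (intro multiset_eqI) simp
    then show ?case by simp
  next
    case (3 p)
    obtain A B where p: "p = (A, B)" by (cases p)
    have eq: "count A i + count B i = (if i < r then g i else 0)" for i
    proof -
      have "A + B = expo_mset g r" using 3 by (simp add: p)
      from arg_cong[OF this, of "\<lambda>M. count M i"] show ?thesis by simp
    qed
    have "count (expo_mset (\<lambda>i. g i - restrict (count B) {..<r} i) r) i = count A i"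
      "count (expo_mset (restrict (count B) {..<r}) r) i = count B i" for i
      using eq[of i] by (cases "i < r"; simp)+
    then have "expo_mset (\<lambda>i. g i - restrict (count B) {..<r} i) r = A" "expo_mset (restrict (count B) {..<r}) r = B"
      by (auto intro!: multiset_eqI simp del: count_expo_mset)
    then show ?case by (simp add: p)
  next
    case (4 p)
    obtain A B where p: "p = (A, B)" by (cases p)
    have "count A i + count B i = (if i < r then g i else 0)" for i
    proof -
      have "A + B = expo_mset g r" using 4 by (simp add: p)
      from arg_cong[OF this, of "\<lambda>M. count M i"] show ?thesis by simp
    qed
    then have "count B i \<le> g i" if "i < r" for i using that by (metis le_add2)
    then show ?case by (auto simp: p)
  next
    case (5 k)
    then show ?case by (simp add: coeff_prod_fps_var set_expo_mset mult.commute)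
  qed
  finally show ?thesis by (simp add: coeff_mult)
qed

section \<open>Stable Grothendieck polynomials\<close>

lemma coeff_alternant_stable:
  assumes "plength la \<le> n" "plength ka \<le> n"
  shows "mps_coeff (alternant b la (Suc n)) (shifted_mset ka (Suc n)) = mps_coeff (alternant b la n) (shifted_mset ka n)"
proof -
  have zero: "part ka n = 0" using assms by (simp add: part_eq_0_iff)
  have *: "shifted_mset ka (Suc n) = expo_mset (\<lambda>_. 1) n + shifted_mset ka n"
    by (rule multiset_eqI) (auto simp: shifted_def zero less_Suc_eq)
  then have set: "set_mset (shifted_mset ka (Suc n)) \<subseteq> {..<n}"
    using set_expo_mset[of _ n] by auto
  have "mps_coeff (alternant b la (Suc n)) (shifted_mset ka (Suc n))
      = mps_coeff (restrict_vars n (alternant b la (Suc n))) (shifted_mset ka (Suc n))"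
    using set by (simp add: coeff_restrict)
  also have "\<dots> = mps_coeff ((\<Prod>i<n. Var i ^ 1) * alternant b la n) (shifted_mset ka (Suc n))"
    by (simp add: restrict_alternant_Suc assms)
  also have "\<dots> = mps_coeff (alternant b la n) (shifted_mset ka n)"
    unfolding prod_Var_power * by (simp add: coeff_mps_monom_mult)
  finally show ?thesis .
qed

text \<open>The coefficient of s_\<kappa> in G_\<lambda>, read off the numerator so that it is
  available before the quotient is known to exist.\<close>

definition grothendieck_coeff :: "partition \<Rightarrow> partition \<Rightarrow> coef" where
  "grothendieck_coeff la ka =
     (let n = max (plength la) (plength ka) in mps_coeff (alternant beta la n) (shifted_mset ka n))"

lemma grothendieck_coeff_eq:
  assumes "plength la \<le> n" "plength ka \<le> n"
  shows "mps_coeff (alternant beta la n) (shifted_mset ka n) = grothendieck_coeff la ka"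
proof -
  have "max (plength la) (plength ka) \<le> n" using assms by simp
  then show ?thesis
  proof (induction rule: dec_induct)
    case base
    show ?case by (simp add: grothendieck_coeff_def Let_def)
  next
    case (step n)
    then show ?case by (simp add: coeff_alternant_stable)
  qed
qed

lemma schur_series_grothendieck:
  assumes "plength la \<le> n"
  shows "restrict_vars n (schur_series (grothendieck_coeff la)) * vandermonde n = alternant beta la n"
proof -
  have "restrict_vars n (schur_series (grothendieck_coeff la)) * vandermonde n = restrict_vars n (alternant beta la n)"
    by (rule symmetric_vandermonde_eqI)
      (use assms in \<open>auto simp: symmetric_schur_series antisymmetric_alternant grothendieck_coeff_eq\<close>)
  then show ?thesis by simp
qed

text \<open>All these coefficients occur in one alternant in \<open>N\<close> variables, which has
  bounded degree and so bounds the size of \<kappa>.\<close>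

lemma finite_grothendieck_coeff: "finite {ka. plength ka \<le> n \<and> grothendieck_coeff la ka \<noteq> 0}"
proof -
  define N where "N = max n (plength la)"
  obtain d where d: "mps_coeff (alternant beta la N) M \<noteq> 0 \<Longrightarrow> size M \<le> d" for M
    using bounded_degree_alternant[of beta la N] unfolding bounded_degree_def by metis
  have "psize ka \<le> d" if "plength ka \<le> n" "grothendieck_coeff la ka \<noteq> 0" for ka
  proof -
    have N: "plength la \<le> N" "plength ka \<le> N" using that by (auto simp: N_def)
    then have "size (shifted_mset ka N) \<le> d"
      using that grothendieck_coeff_eq[OF N] by (intro d) simp
    then show ?thesis
      using psize_eq[OF N(2)] unfolding size_expo_mset shifted_def sum.distrib by simp
  qed
  then show ?thesis by (intro finite_subset[OF _ finite_partitions[of d]]) auto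
qed

lemma stable_grothendieck_eq: "stable_grothendieck la = schur_series (grothendieck_coeff la)"
  unfolding stable_grothendieck_def alternant_def[symmetric]
proof (rule the_equality, intro conjI allI impI)
  show "schur_series (grothendieck_coeff la) \<in> completed_symmetric_functions"
    unfolding completed_symmetric_functions_def using finite_grothendieck_coeff by blast
  show *: "restrict_vars n (schur_series (grothendieck_coeff la)) * vandermonde n = alternant beta la n"
    if "plength la \<le> n" for n
    using that by (rule schur_series_grothendieck)
  fix F assume F: "F \<in> completed_symmetric_functions \<and>
    (\<forall>n\<ge>plength la. restrict_vars n F * vandermonde n = alternant beta la n)"
  show "F = schur_series (grothendieck_coeff la)"
  proof (rule mps_eq_restrictI[of "plength la"])
    fix n assume n: "plength la \<le> n"
    have "restrict_vars n F * vandermonde n = restrict_vars n (schur_series (grothendieck_coeff la)) * vandermonde n"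
      using F n unfolding *[OF n] by blast
    then show "restrict_vars n F = restrict_vars n (schur_series (grothendieck_coeff la))"
      by (rule vandermonde_cancel)
  qed
qed

lemma symmetric_grothendieck [simp]: "symmetric (stable_grothendieck la)"
  by (simp add: stable_grothendieck_eq symmetric_schur_series)

lemma grothendieck_alternant:
  "plength la \<le> n \<Longrightarrow> restrict_vars n (stable_grothendieck la) * vandermonde n = alternant beta la n"
  by (simp add: stable_grothendieck_eq schur_series_grothendieck)

text \<open>Triangularity of G_\<lambda>, with leading term s_\<lambda> and all other terms of
  larger size; uniqueness of the dual family rests on it.\<close>

lemma sym_coeff_grothendieck_delta:
  assumes "psize ka \<le> psize la"
  shows "sym_coeff (stable_grothendieck la) ka = (if ka = la then 1 else 0)"
  by (simp add: stable_grothendieck_eq grothendieck_coeff_def Let_def coeff_alternant_delta assms)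

section \<open>Integer binomial coefficients and binomial series\<close>

lemma int_binomial_gbinomial: "(of_int (int_binomial a n) :: rat) = of_int a gchoose n"
  unfolding int_binomial_def gbinomial_prod_rev[where 'a = int, symmetric] by (rule of_int_gbinomial)

lemma int_binomial_0 [simp]: "int_binomial a 0 = 1"
  by (simp add: int_binomial_def)

text \<open>Pascal's rule is taken over from the rationals, which avoids reasoning about integer
  division.\<close>

lemma int_binomial_Suc: "int_binomial (a + 1) (Suc n) = int_binomial a n + int_binomial a (Suc n)"
proof -
  have "(of_int (int_binomial (a + 1) (Suc n)) :: rat) = of_int (int_binomial a n + int_binomial a (Suc n))"
    using gbinomial_Suc_Suc[of "of_int a :: rat" n] by (simp add: int_binomial_gbinomial)
  then show ?thesis by (simp only: of_int_eq_iff)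
qed

lemma int_binomial_eq_0: "0 \<le> a \<Longrightarrow> a < int n \<Longrightarrow> int_binomial a n = 0"
proof -
  assume "0 \<le> a" "a < int n"
  then have "(\<Prod>i = 0..<n. a - int i) = 0"
    by (intro prod_zero bexI[of _ "nat a"]) auto
  then show "int_binomial a n = 0" unfolding int_binomial_def by (simp only: div_0)
qed

text \<open>The series (1 + \<beta>X)^a, also for negative \<open>a\<close>.\<close>

definition binomial_series :: "int \<Rightarrow> coef fps" where
  "binomial_series a = Abs_fps (\<lambda>n. of_int (int_binomial a n) * beta ^ n)"

lemma binomial_series_Suc: "binomial_series (a + 1) = binomial_series a * (1 + fps_const beta * fps_X)"
proof (rule fps_ext)
  fix n show "fps_nth (binomial_series (a + 1)) n = fps_nth (binomial_series a * (1 + fps_const beta * fps_X)) n"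
  proof (cases n)
    case (Suc m)
    then show ?thesis
      by (simp add: binomial_series_def int_binomial_Suc distrib_left distrib_right mult.left_commute[of _ "fps_const _"])
  qed (simp add: binomial_series_def)
qed

lemma binomial_series_add: "binomial_series (a + int j) = binomial_series a * (1 + fps_const beta * fps_X) ^ j"
proof (induction j)
  case (Suc j)
  have "binomial_series (a + int (Suc j)) = binomial_series (a + int j + 1)" by (simp add: add_ac)
  also have "\<dots> = binomial_series a * (1 + fps_const beta * fps_X) ^ Suc j"
    unfolding binomial_series_Suc Suc.IH by (simp only: power_Suc2 mult.assoc)
  finally show ?case .
qed simp

section \<open>The determinants dual to the stable Grothendieck polynomials\<close>

definition dual_entry :: "partition \<Rightarrow> partition \<Rightarrow> nat \<Rightarrow> nat \<Rightarrow> coef mps" where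
  "dual_entry la mu i j = Sum_any (\<lambda>n. Const (of_int (int_binomial (int j - int i) n) * beta ^ n) *
      complete_sym (int (part la i) - int (part mu j) - int i + int j - int n))"

definition dual_det :: "partition \<Rightarrow> partition \<Rightarrow> nat \<Rightarrow> coef mps" where
  "dual_det la mu r = det (mat r r (\<lambda>(i, j). dual_entry la mu i j))"

text \<open>The series X^(\<mu>_j+\<delta>_j) (1 + \<beta>X)^(j-i). Its convolution with H at
  \<lambda>_i + \<delta>_i is the matrix entry, since the number \<open>r\<close> cancels between
  the two shifts.\<close>

definition dual_fps :: "partition \<Rightarrow> nat \<Rightarrow> nat \<Rightarrow> nat \<Rightarrow> coef fps" where
  "dual_fps mu r i j = fps_X ^ shifted mu r j * binomial_series (int j - int i)"

lemma dual_entry_eq: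
  assumes "i < r" "j < r"
  shows "dual_entry la mu i j = complete_conv (dual_fps mu r i j) (shifted la r i)"
proof -
  let ?s = "shifted mu r j" and ?m = "shifted la r i"
  let ?b = "fps_nth (binomial_series (int j - int i))"
  have eq: "int (part la i) - int (part mu j) - int i + int j - int n = int ?m - int ?s - int n" for n
    using assms by (simp add: shifted_def of_nat_diff)
  have fin: "finite {n. n + ?s \<le> ?m}" by (rule finite_subset[of _ "{..?m}"]) auto
  have "dual_entry la mu i j = Sum_any (\<lambda>n. Const (?b n) * complete_sym (int ?m - int ?s - int n))"
    by (simp add: dual_entry_def eq binomial_series_def)
  \<comment> \<open>Terms beyond this range contain complete functions of negative degree, so the
    formally infinite sum is finite.\<close>
  also have "\<dots> = (\<Sum>n | n + ?s \<le> ?m. Const (?b n) * complete_sym (int ?m - int ?s - int n))"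
    by (rule Sum_any.expand_superset[OF fin]) (auto intro: ccontr)
  also have "\<dots> = (\<Sum>k \<in> {?s..?m}. Const (fps_nth (dual_fps mu r i j) k) * complete_sym (int (?m - k)))"
    by (rule sum.reindex_bij_witness[of _ "\<lambda>k. k - ?s" "\<lambda>n. n + ?s"])
      (auto simp: dual_fps_def fps_X_power_mult_nth of_nat_diff diff_diff_eq add.commute)
  also have "\<dots> = complete_conv (dual_fps mu r i j) ?m"
    unfolding complete_conv_def
    by (rule sum.mono_neutral_left) (auto simp: dual_fps_def fps_X_power_mult_nth)
  finally show ?thesis .
qed

lemma dual_det_eq: "dual_det la mu r = det (mat r r (\<lambda>(i, j). complete_conv (dual_fps mu r i j) (shifted la r i)))"
  unfolding dual_det_def by (rule arg_cong[of _ _ det], rule eq_matI) (auto simp: dual_entry_eq)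

lemma dual_det_symmetric_function [simp]: "dual_det la mu r \<in> symmetric_functions"
  unfolding dual_det_eq by (rule symmetric_functions_det) simp

lemma dual_entry_eq_0:
  assumes "int (part la i) - int (part mu j) - int i + int j < 0"
  shows "dual_entry la mu i j = 0"
  unfolding dual_entry_def using assms by (subst complete_neg) auto

lemma dual_entry_eq_1:
  assumes "part la i = part mu i"
  shows "dual_entry la mu i i = 1"
proof -
  have "dual_entry la mu i i = (\<Sum>n\<in>{0::nat}. Const (of_int (int_binomial 0 n) * beta ^ n) * complete_sym (- int n))"
    unfolding dual_entry_def using assms
    by (subst Sum_any.expand_superset[of "{0}"]) (auto intro: ccontr)
  then show ?thesis by simp
qed

text \<open>In a last row beyond both lengths, entries left of the diagonal have negative degree and
  the diagonal entry is h_0 = 1.\<close>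

lemma dual_det_stable:
  assumes "plength la \<le> r" "plength mu \<le> r" "r \<le> R"
  shows "dual_det la mu R = dual_det la mu r"
  using assms(3)
proof (induction rule: dec_induct)
  case (step n)
  have "dual_det la mu (Suc n) = dual_det la mu n"
    unfolding dual_det_def
    by (rule det_mat_last_row)
      (use step assms in \<open>auto simp: part_eq_0_iff[THEN iffD2] intro!: dual_entry_eq_0 dual_entry_eq_1\<close>)
  then show ?case using step by simp
qed simp

definition binomial_weight :: "nat \<Rightarrow> coef mps" where
  "binomial_weight r = (\<Prod>i<r. fps_var i (binomial_series (- int i)))"

text \<open>The exponent j - i is split: (1 + \<beta>x_i)^(-i) depends on the row only and leaves
  the determinant, (1 + \<beta>x_i)^j stays in the alternant.\<close>

lemma det_dual_fps:
  "det (mat r r (\<lambda>(i, j). fps_var i (dual_fps mu r i j))) = binomial_weight r * alternant beta mu r"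
proof -
  have "fps_var i (dual_fps mu r i j) = fps_var i (binomial_series (- int i)) *
      fps_var i (fps_X ^ shifted mu r j * (1 + fps_const beta * fps_X) ^ j)" for i j
    using binomial_series_add[of "- int i" j]
    by (simp add: dual_fps_def mult_ac flip: fps_var.hom_mult)
  then show ?thesis
    unfolding alternant_fps binomial_weight_def by (simp only: det_mat_mult_rows)
qed

lemma hall_of_int_mult:
  "symmetric F \<Longrightarrow> f \<in> symmetric_functions \<Longrightarrow> hall F (of_int k * f) = of_int k * hall F f"
  using hall_Const_mult[of F f "of_int k"] by (simp add: Const.hom_of_int)

text \<open>Each Leibniz term is a product of convolutions, to which the duality applies; the
  resulting products of series in separate variables recombine to the determinant in
  \<open>det_dual_fps\<close>.\<close>

lemma hall_dual_det:
  assumes "symmetric F"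
  shows "hall F (dual_det la mu r)
    = mps_coeff (F * (binomial_weight r * alternant beta mu r)) (shifted_mset la r)"
proof -
  let ?c = "\<lambda>p. \<Prod>i<r. complete_conv (dual_fps mu r i (p i)) (shifted la r i)"
  let ?v = "\<lambda>p. \<Prod>i<r. fps_var i (dual_fps mu r i (p i))"
  have c: "?c p \<in> symmetric_functions" for p
    by (intro symmetric_functions_prod) simp
  have "hall F (dual_det la mu r) = hall F (\<Sum>p | p permutes {..<r}. of_int (sign p) * ?c p)"
    unfolding dual_det_eq det_mat_permutes_expand ..
  also have "\<dots> = (\<Sum>p | p permutes {..<r}. of_int (sign p) * mps_coeff (F * ?v p) (shifted_mset la r))"
    using assms c by (subst hall_sum) (auto intro!: symmetric_functions_mult sum.cong
        simp: hall_of_int_mult hall_prod_complete_conv)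
  also have "\<dots> = mps_coeff (F * (\<Sum>p | p permutes {..<r}. of_int (sign p) * ?v p)) (shifted_mset la r)"
    by (simp add: sum_distrib_left mult.left_commute[of F])
  finally show ?thesis
    unfolding det_dual_fps[symmetric] det_mat_permutes_expand .
qed

text \<open>For the empty partition the alternant is the Vandermonde product, which G_\<mu> turns
  into the alternant of \<mu>.\<close>

lemma hall_grothendieck_mult_dual_det:
  assumes "symmetric h" "plength mu \<le> r"
  shows "hall (stable_grothendieck mu * h) (dual_det la empty_partition r) = hall h (dual_det la mu r)"
proof -
  let ?G = "stable_grothendieck mu" and ?w = "binomial_weight r" and ?M = "shifted_mset la r"
  have "hall (?G * h) (dual_det la empty_partition r) = mps_coeff ((?G * h) * (?w * vandermonde r)) ?M"
    using assms by (simp add: hall_dual_det symmetric_hom alternant_empty)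
  \<comment> \<open>The monomial uses only the first \<open>r\<close> variables, so restricting
    keeps its coefficient; the quotient formula for G_\<mu> is available only after
    restriction.\<close>
  also have "\<dots> = mps_coeff (restrict_vars r (?G * h) * restrict_vars r (?w * vandermonde r)) ?M"
    by (rule coeff_mult_restrict[OF set_expo_mset])
  also have "restrict_vars r (?G * h) * restrict_vars r (?w * vandermonde r)
      = restrict_vars r h * restrict_vars r ?w * (restrict_vars r ?G * vandermonde r)"
    by (simp add: restrict.hom_mult mult_ac)
  also have "\<dots> = restrict_vars r h * restrict_vars r (?w * alternant beta mu r)"
    by (simp add: grothendieck_alternant assms(2) restrict.hom_mult mult.assoc)
  also have "mps_coeff \<dots> ?M = mps_coeff (h * (?w * alternant beta mu r)) ?M"
    by (rule coeff_mult_restrict[OF set_expo_mset, symmetric])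
  also have "\<dots> = hall h (dual_det la mu r)"
    using assms by (simp add: hall_dual_det)
  finally show ?thesis .
qed

lemma symmetric_1 [simp]: "symmetric (1 :: 'a :: comm_ring_1 mps)"
  using symmetric_Const[of "1 :: 'a"] by simp

text \<open>
  A nonzero product along a permutation \<open>p\<close> requires \<open>\<lambda>\<^sub>i \<le> \<mu>\<^sub>p\<^sub>(\<^sub>i\<^sub>)\<close> where \<open>i < p(i)\<close>, equality where
  \<open>i = p(i)\<close>, and \<open>\<lambda>\<^sub>i > \<mu>\<^sub>p\<^sub>(\<^sub>i\<^sub>)\<close> where \<open>i > p(i)\<close>; together these force \<open>p = id\<close> and \<open>\<lambda> = \<mu>\<close>.
\<close>

lemma hall_1_dual_det:
  assumes la: "plength la \<le> r" and mu: "plength mu \<le> r"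
  shows "hall 1 (dual_det la mu r) = (if la = mu then 1 else 0)"
proof -
  define f where "f i j = fps_nth (dual_fps mu r i j) (shifted la r i)" for i j
  have f: "f i j = (if shifted la r i < shifted mu r j then 0
      else of_int (int_binomial (int j - int i) (shifted la r i - shifted mu r j)) * beta ^ (shifted la r i - shifted mu r j))"
    for i j
    by (simp add: f_def dual_fps_def fps_X_power_mult_nth binomial_series_def)
  \<comment> \<open>If \<lambda>_i > \<mu>_j, the upper argument j - i of the binomial is
    nonnegative and below the lower one.\<close>
  have up: "part la i \<le> part mu j" if "i < j" "j < r" "f i j \<noteq> 0" for i j
  proof (rule ccontr)
    assume "\<not> ?thesis"
    then have "int_binomial (int j - int i) (shifted la r i - shifted mu r j) = 0"
      using that by (intro int_binomial_eq_0) (auto simp: shifted_def)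
    then show False using that(3) by (simp add: f split: if_splits)
  qed
  have diag: "part la i = part mu i" if "f i i \<noteq> 0" for i
  proof (rule ccontr)
    assume "part la i \<noteq> part mu i"
    then have "part mu i < part la i" using that by (auto simp: f shifted_def split: if_splits)
    then have "int_binomial (int i - int i) (shifted la r i - shifted mu r i) = 0"
      by (intro int_binomial_eq_0) (auto simp: shifted_def)
    then show False using that by (simp add: f split: if_splits)
  qed
  \<comment> \<open>A nonnegative exponent already gives \<lambda>_i - \<mu>_j \<ge> i - j >
    0.\<close>
  have down: "part mu j < part la i" if "j < i" "i < r" "f i j \<noteq> 0" for i j
    using that by (auto simp: f shifted_def split: if_splits)
  have *: "p = id \<and> la = mu" if p: "p permutes {..<r}" and nz: "\<And>i. i < r \<Longrightarrow> f i (p i) \<noteq> 0" for p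
  proof -
    \<comment> \<open>By induction the values below \<open>k\<close> are taken, so
      \<open>k \<le> p k\<close>, and the preimage \<open>i\<close> of \<open>k\<close> is at least
      \<open>k\<close>. If it were larger, then \<mu>_k < \<lambda>_i \<le> \<lambda>_k \<le>
      \<mu>_(p k) \<le> \<mu>_k.\<close>
    have fixed: "p k = k \<and> part la k = part mu k" if "k < r" for k
      using that
    proof (induction k rule: less_induct)
      case (less k)
      have inj: "p i = p j \<Longrightarrow> i = j" for i j using permutes_inj[OF p] by (auto dest: injD)
      have pk: "p k < r" using permutes_in_image[OF p, of k] less.prems by simp
      have "k \<le> p k"
      proof (rule ccontr)
        assume "\<not> k \<le> p k"
        then have "p (p k) = p k" using less.IH[of "p k"] pk by simp
        then show False using inj \<open>\<not> k \<le> p k\<close> by fastforce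
      qed
      then have "part la k \<le> part mu (p k)"
        using up[of k "p k"] diag[of k] nz[OF less.prems] pk by (cases "k = p k") auto
      also have "\<dots> \<le> part mu k" by (rule part_antimono) fact
      finally have le: "part la k \<le> part mu k" .
      obtain i where i: "p i = k" using surjD[OF permutes_surj[OF p], of k] by auto
      have ir: "i < r" using permutes_in_image[OF p, of i] less.prems i by simp
      have "k \<le> i"
        using less.IH[of i] ir i by (cases "i < k") auto
      moreover have "\<not> k < i"
      proof
        assume "k < i"
        then have "part mu k < part la i" using down[of k i] nz[OF ir] i ir by simp
        also have "\<dots> \<le> part la k" using \<open>k < i\<close> by (intro part_antimono) simp
        finally show False using le by simp
      qed
      ultimately have "p k = k" using i by simp
      then show ?case using diag[of k] nz[OF less.prems] by simp
    qed
    have "p i = i" for i using fixed[of i] permutes_not_in[OF p, of i] by (cases "i < r") auto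
    moreover have "part la i = part mu i" for i
      using fixed[of i] la mu by (cases "i < r") (auto simp: part_eq_0_iff[THEN iffD2])
    ultimately show ?thesis by (auto intro: partition_eqI)
  qed
  have "hall 1 (dual_det la mu r) = det (mat r r (\<lambda>(i, j). f i j))"
    by (simp add: hall_dual_det f_def coeff_expo_mset_det_fps_var flip: det_dual_fps)
  also have "\<dots> = (if la = mu then 1 else 0)"
    by (rule det_mat_delta, rule *) (simp_all add: f)
  finally show ?thesis .
qed

lemma hall_grothendieck_dual_det:
  assumes "plength la \<le> r"
  shows "hall (stable_grothendieck nu) (dual_det la empty_partition r) = (if nu = la then 1 else 0)"
proof -
  \<comment> \<open>\<nu> may have more than \<open>r\<close> parts; stability allows the
    determinant to be enlarged until it covers both partitions.\<close>
  define R where "R = max r (plength nu)"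
  have R: "plength la \<le> R" "plength nu \<le> R" using assms by (auto simp: R_def)
  have "dual_det la empty_partition r = dual_det la empty_partition R"
    by (rule dual_det_stable[symmetric]) (use assms in \<open>auto simp: R_def\<close>)
  then show ?thesis
    using hall_grothendieck_mult_dual_det[of 1 nu R la] R by (auto simp: hall_1_dual_det)
qed

text \<open>If \<open>d\<close> were nonzero, take \<kappa> of maximal size in its Schur expansion.
  By triangularity the pairing with G_\<kappa> sees only the coefficient at \<kappa>.\<close>

lemma dual_grothendieck_unique:
  assumes d: "d \<in> symmetric_functions" and zero: "\<And>nu. hall (stable_grothendieck nu) d = 0"
  shows "d = 0"
proof -
  let ?S = "{la. sym_coeff d la \<noteq> 0}"
  have "?S = {}"
  proof (rule ccontr)
    assume "?S \<noteq> {}"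
    then have "Max (psize ` ?S) \<in> psize ` ?S"
      using finite_sym_coeff[OF d] by (intro Max_in) auto
    then obtain ka where ka: "sym_coeff d ka \<noteq> 0" "psize ka = Max (psize ` ?S)" by auto
    have max: "psize nu \<le> psize ka" if "sym_coeff d nu \<noteq> 0" for nu
      unfolding ka(2) using that finite_sym_coeff[OF d] by (intro Max_ge) auto
    have "hall (stable_grothendieck ka) d = Sum_any (\<lambda>nu. if nu = ka then sym_coeff d nu else 0)"
      unfolding hall_eq[OF symmetric_grothendieck symmetric_functions_symmetric[OF d]]
    proof (rule arg_cong[of _ _ Sum_any], rule ext)
      fix nu
      show "sym_coeff (stable_grothendieck ka) nu * sym_coeff d nu = (if nu = ka then sym_coeff d nu else 0)"
        using max[of nu] by (cases "sym_coeff d nu = 0") (auto simp: sym_coeff_grothendieck_delta)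
    qed
    then show False using zero[of ka] ka(1) by simp
  qed
  then show ?thesis
    by (intro symmetric_eqI) (use d in \<open>auto simp: symmetric_functions_symmetric sym_coeff_def\<close>)
qed

lemma dual_grothendieck_eq:
  assumes "plength la \<le> r"
  shows "dual_grothendieck la = dual_det la empty_partition r"
  unfolding dual_grothendieck_def
proof (rule the_equality, intro conjI allI)
  fix g assume g: "g \<in> symmetric_functions \<and>
    (\<forall>nu. hall (stable_grothendieck nu) g = (if nu = la then 1 else 0))"
  have "g - dual_det la empty_partition r = 0"
    by (rule dual_grothendieck_unique)
      (use g assms in \<open>auto simp: symmetric_functions_diff hall_diff hall_grothendieck_dual_det\<close>)
  then show "g = dual_det la empty_partition r" by simp
qed (use assms in \<open>simp_all add: hall_grothendieck_dual_det\<close>)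

theorem proposition5p2:
  fixes la mu :: partition and r :: nat
  assumes "contained mu la"
    and "r \<ge> 1"
    and "plength la \<le> r"
  shows "skew_dual_grothendieck la mu =
    det (mat r r (\<lambda>(i, j). Sum_any (\<lambda>n :: nat.
      Const (of_int (int_binomial (int j - int i) n) * beta ^ n) *
      complete_sym (int (part la i) - int (part mu j) - int i + int j - int n))))"
proof -
  have "part mu r = 0"
    using assms(1,3) part_eq_0_iff[of la r] unfolding contained_def by (metis le_0_eq)
  then have mu: "plength mu \<le> r" by (simp add: part_eq_0_iff)
  \<comment> \<open>The adjunction yields the determinant as second argument; commutativity of the
    pairing puts it first, as in the definition.\<close>
  have dual: "hall (stable_grothendieck mu * h) (dual_grothendieck la) = hall (dual_det la mu r) h"
    if "h \<in> symmetric_functions" for h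
    using that mu assms(3)
    by (simp add: dual_grothendieck_eq hall_grothendieck_mult_dual_det symmetric_functions_symmetric
        hall_commute[of h])
  have "skew_dual_grothendieck la mu = dual_det la mu r"
    unfolding skew_dual_grothendieck_def
  proof (rule the_equality, intro conjI ballI)
    fix g assume g: "g \<in> symmetric_functions \<and>
      (\<forall>h\<in>symmetric_functions. hall g h = hall (stable_grothendieck mu * h) (dual_grothendieck la))"
    \<comment> \<open>Testing against Schur functions yields all Schur coefficients, which determine
      a symmetric series.\<close>
    then have "hall g (schur nu) = hall (dual_det la mu r) (schur nu)" for nu
      using dual[of "schur nu"] by simp
    then show "g = dual_det la mu r"
      using g by (intro symmetric_eqI) (simp_all add: symmetric_functions_symmetric hall_schur)
  qed (simp_all add: dual)
  then show ?thesis by (simp add: dual_det_def dual_entry_def)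
qed

end
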